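(* Let $\Omega\subset\mathbb{R}$ be a bounded open interval, let $a>0$, $D>0$, $C_F>0$ and $\alpha\in(0,1)$. Then for all positive numbers $M$, $\underline\gamma$, $\overline\gamma$ and $T_\star$ there exists a constant $\delta_\star=\delta_\star(M,T_\star,a,D,\Omega,\underline\gamma,\overline\gamma,C_F,\alpha)>0$, depending only on the indicated quantities, with the following property. Suppose that $F\in C^1([0,\infty))$ satisfies $F(0)=0$ and $|F(s)|\le C_F(1+s)^\alpha$ for all $s\ge 0$; that $\gamma\in C^2([0,\infty))$, $\Gamma\in C^1([0,\infty))$ and $f\in C^2([0,\infty))$ with $\gamma>0$ and $\Gamma\ge 0$ on $[0,\infty)$; that $$\underline\gamma\le\gamma(s)\le\overline\gamma\quad\text{and}\quad 0\le\Gamma(s)\le\overline\gamma\qquad\text{for all } s\in[0,\infty),$$ $$\|\gamma'\|_{L^\infty([0,\infty))}\le\delta_\star\quad\text{and}\quad \|f'\|_{L^\infty([0,\infty))}\le\delta_\star;$$ and that, for some $\mu\in(0,1)$, the initial data satisfy $$u_0\in C^2(\overline\Omega),\ \tfrac{\partial u_0}{\partial\nu}=0 \text{ on }\partial\Omega;\qquad u_{0t}\in C^{1+\mu}(\overline\Omega),\ \tfrac{\partial u_{0t}}{\partial\nu}=0\text{ on }\partial\Omega;\qquad \Theta_0\in C^{1+\mu}(\overline\Omega),\ \Theta_0\ge 0\text{ in }\Omega,\ \Theta_0=0\text{ on }\partial\Omega,$$ and $$\int_\Omega u_{0tx}^2+\int_\Omega u_{0x}^2+\int_\Omega u_{0x}^4+\int_\Omega\Theta_{0x}^2\le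 M.$$ Let $T_{max}\in(0,\infty]$ and $(u,\Theta)$ be a maximal classical solution (in the sense specified in the context) of $$\begin{cases} u_{tt}=(\gamma(\Theta)u_{xt})_x+a(\gamma(\Theta)u_x)_x+(f(\Theta))_x, & x\in\Omega,\ t>0,\\ \Theta_t=D\Theta_{xx}+\Gamma(\Theta)u_{xt}^2+F(\Theta)u_{xt}, & x\in\Omega,\ t>0,\\ \frac{\partial u}{\partial\nu}=0,\quad \Theta=0, & x\in\partial\Omega,\ t>0,\\ u(x,0)=u_0(x),\quad u_t(x,0)=u_{0t}(x),\quad\Theta(x,0)=\Theta_0(x), & x\in\Omega.\end{cases}$$ Then $T_{max}\ge T_\star$.
   Context: $\frac{\partial}{\partial\nu}$ is the outward normal derivative on $\partial\Omega$ (so the homogeneous Neumann condition for $u$ means $u_x=0$ at both endpoints). $C^{1+\eta,\frac{1+\eta}{2}}$ denotes the usual parabolic Hölder spaces, and $C^{2,1}$ the space of functions that are $C^2$ in $x$ and $C^1$ in $t$ (with these derivatives jointly continuous). Maximal classical solution: the paper's local existence result provides, for coefficients and initial data as in the claim (without any smallness assumption), some $T_{max}\in(0,\infty]$ and functions $u,\Theta$ on $\overline\Omega\times[0,T_{max})$ such that each of $u$, $u_t$ and $\Theta$ belongs to $$\Big(\bigcup_{\eta\in(0,1)}C^{1+\eta,\frac{1+\eta}{2}}(\overline\Omega\times[0,T_{max}))\Big)\cap C^{2,1}(\overline\Omega\times(0,T_{max})),$$ such that $\Theta\ge 0$ in $\Omega\times(0,T_{max})$, such that $(u,\Theta)$ solves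 the initial-boundary value problem in the classical pointwise sense in $\Omega\times(0,T_{max})$, and such that the following extensibility criterion holds: $$\text{if } T_{max}<\infty,\ \text{ then }\ \limsup_{t\nearrow T_{max}}\Big\{\|u_t(\cdot,t)\|_{W^{1,2}(\Omega)}+\|\Theta(\cdot,t)\|_{L^\infty(\Omega)}\Big\}=\infty.$$ A triple $(T_{max},u,\Theta)$ with all these properties is what is called a maximal classical solution in the claim. *)

theory Defs
  imports "HOL-Analysis.Analysis" "HOL-Probability.Essential_Supremum"
begin

section \<open>Functions of one variable\<close>

text \<open>
  All derivatives are taken relative to the set on which the function lives, hence they are
  one-sided at boundary points, and values outside that set play no role.
\<close>

definition deriv_on :: "real set \<Rightarrow> (real \<Rightarrow> real) \<Rightarrow> real \<Rightarrow> real" where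
  "deriv_on S g x = vector_derivative g (at x within S)"

primrec Ck_on :: "nat \<Rightarrow> real set \<Rightarrow> (real \<Rightarrow> real) \<Rightarrow> bool" where
  "Ck_on 0 S g \<longleftrightarrow> continuous_on S g"
| "Ck_on (Suc k) S g \<longleftrightarrow> g differentiable_on S \<and> Ck_on k S (deriv_on S g)"

text \<open>The space \<open>C\<^sup>1\<^sup>+\<^sup>\<mu>(S)\<close>.\<close>

definition C1_holder_on :: "real \<Rightarrow> real set \<Rightarrow> (real \<Rightarrow> real) \<Rightarrow> bool" where
  "C1_holder_on \<mu> S g \<longleftrightarrow> Ck_on 1 S g \<and>
     (\<exists>C. \<forall>x\<in>S. \<forall>y\<in>S. \<bar>deriv_on S g x - deriv_on S g y\<bar> \<le> C * \<bar>x - y\<bar> powr \<mu>)"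

definition Linfty_norm :: "real set \<Rightarrow> (real \<Rightarrow> real) \<Rightarrow> ereal" where
  "Linfty_norm S g = esssup (lebesgue_on S) (\<lambda>x. ereal \<bar>g x\<bar>)"

text \<open>The \<open>W\<^sup>1\<^sup>,\<^sup>2(S)\<close> norm. It is only applied to functions that are \<open>C\<^sup>1\<close> up to the boundary of
  an interval, for which the weak derivative is the classical one.\<close>

definition W12_norm :: "real set \<Rightarrow> (real \<Rightarrow> real) \<Rightarrow> real" where
  "W12_norm S g =
     sqrt ((\<integral>x. (g x)\<^sup>2 \<partial>lebesgue_on S) + (\<integral>x. (deriv_on S g x)\<^sup>2 \<partial>lebesgue_on S))"

section \<open>Functions of space and time\<close>

text \<open>A function of space and time is written \<open>w x t\<close>, with \<open>x \<in> K\<close> and \<open>t \<in> J\<close>.\<close>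

definition dx :: "real set \<Rightarrow> (real \<Rightarrow> real \<Rightarrow> real) \<Rightarrow> real \<Rightarrow> real \<Rightarrow> real" where
  "dx K w x t = deriv_on K (\<lambda>y. w y t) x"

definition dt :: "real set \<Rightarrow> (real \<Rightarrow> real \<Rightarrow> real) \<Rightarrow> real \<Rightarrow> real \<Rightarrow> real" where
  "dt J w x t = deriv_on J (\<lambda>s. w x s) t"

text \<open>The parabolic Hoelder space \<open>C\<^sup>1\<^sup>+\<^sup>\<eta>\<^sup>,\<^sup>(\<^sup>1\<^sup>+\<^sup>\<eta>\<^sup>)\<^sup>/\<^sup>2(K \<times> J)\<close>.\<close>

definition parabolic_holder ::
    "real \<Rightarrow> real set \<Rightarrow> real set \<Rightarrow> (real \<Rightarrow> real \<Rightarrow> real) \<Rightarrow> bool" where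
  "parabolic_holder \<eta> K J w \<longleftrightarrow>
     (\<forall>t\<in>J. (\<lambda>y. w y t) differentiable_on K) \<and>
     (\<exists>C. (\<forall>x\<in>K. \<forall>t\<in>J. \<bar>w x t\<bar> \<le> C \<and> \<bar>dx K w x t\<bar> \<le> C) \<and>
          (\<forall>x\<in>K. \<forall>y\<in>K. \<forall>t\<in>J. \<forall>s\<in>J.
             \<bar>dx K w x t - dx K w y s\<bar> \<le> C * (\<bar>x - y\<bar> powr \<eta> + \<bar>t - s\<bar> powr (\<eta> / 2))) \<and>
          (\<forall>x\<in>K. \<forall>t\<in>J. \<forall>s\<in>J. \<bar>w x t - w x s\<bar> \<le> C * \<bar>t - s\<bar> powr ((1 + \<eta>) / 2)))"

definition C21_on :: "real set \<Rightarrow> real set \<Rightarrow> (real \<Rightarrow> real \<Rightarrow> real) \<Rightarrow> bool" where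
  "C21_on K J w \<longleftrightarrow>
     (\<forall>t\<in>J. (\<lambda>x. w x t) differentiable_on K) \<and>
     (\<forall>t\<in>J. (\<lambda>x. dx K w x t) differentiable_on K) \<and>
     (\<forall>x\<in>K. (\<lambda>t. w x t) differentiable_on J) \<and>
     continuous_on (K \<times> J) (\<lambda>(x, t). w x t) \<and>
     continuous_on (K \<times> J) (\<lambda>(x, t). dx K w x t) \<and>
     continuous_on (K \<times> J) (\<lambda>(x, t). dx K (dx K w) x t) \<and>
     continuous_on (K \<times> J) (\<lambda>(x, t). dt J w x t)"

definition time_Ico :: "ereal \<Rightarrow> real set" where
  "time_Ico T = {t. 0 \<le> t \<and> ereal t < T}"

definition time_Ioo :: "ereal \<Rightarrow> real set" where
  "time_Ioo T = {t. 0 < t \<and> ereal t < T}"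

text \<open>
  As usual, membership in a parabolic Hoelder space over the half-open time interval
  \<open>[0, T)\<close> is understood locally in time, i.e. over every compact \<open>[0, T']\<close> with \<open>T' < T\<close>.
\<close>

definition solution_space :: "real \<Rightarrow> real \<Rightarrow> ereal \<Rightarrow> (real \<Rightarrow> real \<Rightarrow> real) \<Rightarrow> bool" where
  "solution_space l r T w \<longleftrightarrow>
     (\<exists>\<eta>. 0 < \<eta> \<and> \<eta> < 1 \<and>
        (\<forall>T'. 0 < T' \<and> ereal T' < T \<longrightarrow> parabolic_holder \<eta> {l..r} {0..T'} w)) \<and>
     C21_on {l..r} (time_Ioo T) w"

section \<open>The initial-boundary value problem\<close>

text \<open>
  Here the domain is the interval from \<open>l\<close> to \<open>r\<close>. Existence of all derivatives in the
  equations follows from the regularity required in \<open>maximal_classical_solution\<close>.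
\<close>

definition classical_solution ::
    "real \<Rightarrow> real \<Rightarrow> real \<Rightarrow> real \<Rightarrow>
     (real \<Rightarrow> real) \<Rightarrow> (real \<Rightarrow> real) \<Rightarrow> (real \<Rightarrow> real) \<Rightarrow> (real \<Rightarrow> real) \<Rightarrow>
     (real \<Rightarrow> real) \<Rightarrow> (real \<Rightarrow> real) \<Rightarrow> (real \<Rightarrow> real) \<Rightarrow>
     ereal \<Rightarrow> (real \<Rightarrow> real \<Rightarrow> real) \<Rightarrow> (real \<Rightarrow> real \<Rightarrow> real) \<Rightarrow> bool" where
  "classical_solution l r a D \<gamma> \<Gamma> f F u0 u0t \<theta>0 T u \<theta> \<longleftrightarrow>
    (let K = {l..r}; J = time_Ico T; ux = dx K u; ut = dt J u; uxt = dx K ut in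
      (\<forall>x\<in>{l<..<r}. \<forall>t\<in>time_Ioo T.
         dt J ut x t =
           dx K (\<lambda>y s. \<gamma> (\<theta> y s) * uxt y s) x t +
           a * dx K (\<lambda>y s. \<gamma> (\<theta> y s) * ux y s) x t +
           dx K (\<lambda>y s. f (\<theta> y s)) x t \<and>
         dt J \<theta> x t =
           D * dx K (dx K \<theta>) x t + \<Gamma> (\<theta> x t) * (uxt x t)\<^sup>2 + F (\<theta> x t) * uxt x t) \<and>
      (\<forall>x\<in>{l, r}. \<forall>t\<in>time_Ioo T. ux x t = 0 \<and> \<theta> x t = 0) \<and>
      (\<forall>x\<in>{l<..<r}. u x 0 = u0 x \<and> ut x 0 = u0t x \<and> \<theta> x 0 = \<theta>0 x))"

definition maximal_classical_solution ::
    "real \<Rightarrow> real \<Rightarrow> real \<Rightarrow> real \<Rightarrow>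
     (real \<Rightarrow> real) \<Rightarrow> (real \<Rightarrow> real) \<Rightarrow> (real \<Rightarrow> real) \<Rightarrow> (real \<Rightarrow> real) \<Rightarrow>
     (real \<Rightarrow> real) \<Rightarrow> (real \<Rightarrow> real) \<Rightarrow> (real \<Rightarrow> real) \<Rightarrow>
     ereal \<Rightarrow> (real \<Rightarrow> real \<Rightarrow> real) \<Rightarrow> (real \<Rightarrow> real \<Rightarrow> real) \<Rightarrow> bool" where
  "maximal_classical_solution l r a D \<gamma> \<Gamma> f F u0 u0t \<theta>0 Tmax u \<theta> \<longleftrightarrow>
    (let ut = dt (time_Ico Tmax) u in
      0 < Tmax \<and>
      (\<forall>x\<in>{l..r}. (\<lambda>t. u x t) differentiable_on time_Ico Tmax) \<and>
      solution_space l r Tmax u \<and> solution_space l r Tmax ut \<and> solution_space l r Tmax \<theta> \<and>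
      (\<forall>x\<in>{l<..<r}. \<forall>t\<in>time_Ioo Tmax. 0 \<le> \<theta> x t) \<and>
      classical_solution l r a D \<gamma> \<Gamma> f F u0 u0t \<theta>0 Tmax u \<theta> \<and>
      (Tmax < \<infinity> \<longrightarrow>
         Limsup (at_left (real_of_ereal Tmax))
           (\<lambda>t. ereal (W12_norm {l<..<r} (\<lambda>x. ut x t)) +
                Linfty_norm {l<..<r} (\<lambda>x. \<theta> x t)) = \<infinity>))"

end

theory Submission
  imports Defs
begin

text \<open>
  The function \<open>w = u\<^sub>t + a u\<close> satisfies \<open>w\<^sub>t = (\<gamma>(\<theta>) w\<^sub>x + f(\<theta>))\<^sub>x + a u\<^sub>t\<close>. Testing with \<open>w\<^sub>x\<^sub>x\<close>,
  the terms with \<open>\<gamma>'\<close> and \<open>f'\<close> are at most of order \<open>\<delta>\<^sup>2 \<integral> \<theta>\<^sub>x\<^sup>2 (1 + \<integral> w\<^sub>x\<^sub>x\<^sup>2)\<close> after Young's inequality,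
  because \<open>w\<^sub>x\<close> vanishes on the boundary and hence \<open>\<parallel>w\<^sub>x\<parallel>\<^sub>\<infinity>\<^sup>2 \<le> \<bar>\<Omega>\<bar> \<integral> w\<^sub>x\<^sub>x\<^sup>2\<close>. As long as
  \<open>\<delta>\<^sup>2 \<integral> \<theta>\<^sub>x\<^sup>2\<close> stays below a fixed constant they are absorbed, and Gronwall's inequality bounds
  \<open>\<integral> w\<^sub>x\<^sup>2 + \<integral> u\<^sub>x\<^sup>2\<close> and \<open>\<integral>\<integral> w\<^sub>x\<^sub>x\<^sup>2\<close> independently of \<open>\<delta>\<close>. These control
  \<open>\<integral>\<integral> u\<^sub>x\<^sub>t\<^sup>4\<close>, and testing the heat equation with \<open>\<theta>\<^sub>x\<^sub>x\<close> bounds \<open>\<integral> \<theta>\<^sub>x\<^sup>2\<close> up to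
  \<open>T\<^sub>\<star>\<close> by a constant that again does not depend on \<open>\<delta>\<close>. For small \<open>\<delta>\<close> the smallness condition is
  therefore never violated, by continuity. Since \<open>\<integral> u\<^sub>t\<close> is conserved, the norms in the
  extensibility criterion stay bounded, so that the solution cannot end before \<open>T\<^sub>\<star>\<close>.
\<close>

section \<open>Calculus on an interval\<close>

lemma continuous_on_if_has_real_derivative:
  assumes "\<And>x. x \<in> S \<Longrightarrow> (g has_real_derivative g' x) (at x within S)"
  shows "continuous_on S g"
  using assms DERIV_continuous continuous_on_eq_continuous_within by blast

text \<open>The outer function is differentiable only relative to \<open>S\<close>. This is the
  situation of \<gamma>(\<theta>) and f(\<theta>): the coefficients live on the half-line, and
  \<theta> attains its endpoint 0.\<close>

lemma chain_rule_into:
  assumes "(k has_real_derivative k') (at (p x) within S)" "p ` K \<subseteq> S"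
    and "(p has_real_derivative p') (at x within K)"
  shows "((\<lambda>x. k (p x)) has_real_derivative k' * p') (at x within K)"
  using DERIV_image_chain[OF DERIV_subset[OF assms(1,2)] assms(3)] by (simp add: o_def)

lemma real_derivative_unique_Icc:
  assumes "l < r" "x \<in> {l..r}"
    and "(g has_real_derivative d) (at x within {l..r})"
    and "(g has_real_derivative d') (at x within {l..r})"
  shows "d = d'"
  using assms vector_derivative_unique_within_closed_interval[of l r x g d d']
  by (simp add: has_real_derivative_iff_has_vector_derivative)

text \<open>The boundary condition concerns the product, so at each endpoint either factor may
  vanish. This serves Neumann and Dirichlet data alike.\<close>

lemma integral_by_parts_zero:
  fixes p q :: "real \<Rightarrow> real"
  assumes "l \<le> r"
    and p: "\<And>x. x \<in> {l..r} \<Longrightarrow> (p has_real_derivative p' x) (at x within {l..r})"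
    and q: "\<And>x. x \<in> {l..r} \<Longrightarrow> (q has_real_derivative q' x) (at x within {l..r})"
    and p': "continuous_on {l..r} p'" and q': "continuous_on {l..r} q'"
    and "p l * q l = 0" "p r * q r = 0"
  shows "integral {l..r} (\<lambda>x. p x * q' x) = - integral {l..r} (\<lambda>x. p' x * q x)"
proof -
  note c = continuous_on_if_has_real_derivative[OF p] continuous_on_if_has_real_derivative[OF q]
  have "((\<lambda>x. p' x * q x + p x * q' x) has_integral p r * q r - p l * q l) {l..r}"
    using assms(1)
    by (intro fundamental_theorem_of_calculus)
      (auto simp flip: has_real_derivative_iff_has_vector_derivative
        intro!: derivative_eq_intros p q)
  then have "integral {l..r} (\<lambda>x. p' x * q x + p x * q' x) = 0"
    using assms by (simp add: integral_unique)
  then show ?thesis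
    by (subst (asm) integral_add)
      (auto intro!: integrable_continuous_real continuous_intros c p' q')
qed

text \<open>Cauchy--Schwarz enters through the nonnegativity of the integral of the square of the
  derivative minus its mean slope.\<close>

lemma square_le_integral_deriv_square:
  fixes p :: "real \<Rightarrow> real"
  assumes p: "\<And>x. x \<in> {l..r} \<Longrightarrow> (p has_real_derivative p' x) (at x within {l..r})"
    and p': "continuous_on {l..r} p'"
    and xy: "l \<le> y" "y \<le> x" "x \<le> r"
  shows "(p x - p y)\<^sup>2 \<le> (r - l) * integral {l..r} (\<lambda>x. (p' x)\<^sup>2)"
proof (cases "y = x")
  case True
  then show ?thesis using xy
    by (auto intro!: mult_nonneg_nonneg integral_nonneg integrable_continuous_real
        continuous_intros p')
next
  case False
  with xy have yx: "y < x" by simp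
  define c where "c = (p x - p y) / (x - y)"
  have sub: "{y..x} \<subseteq> {l..r}" using xy by auto
  have c': "continuous_on {y..x} p'" using p' sub continuous_on_subset by blast
  have ftc: "(p' has_integral p x - p y) {y..x}"
    using yx sub
    by (intro fundamental_theorem_of_calculus)
      (auto simp flip: has_real_derivative_iff_has_vector_derivative
        intro: DERIV_subset[OF p])
  have "0 \<le> integral {y..x} (\<lambda>z. (p' z - c)\<^sup>2)"
    by (intro integral_nonneg integrable_continuous_real continuous_intros c') auto
  also have "\<dots> = integral {y..x} (\<lambda>z. (p' z)\<^sup>2 - 2 * c * p' z + c\<^sup>2)"
    by (intro integral_cong) (simp add: power2_eq_square algebra_simps)
  also have "\<dots> = integral {y..x} (\<lambda>z. (p' z)\<^sup>2) - 2 * c * (p x - p y) + c\<^sup>2 * (x - y)"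
    using yx integral_unique[OF ftc]
    by (subst integral_add integral_diff,
        (intro integrable_continuous_real continuous_intros c')+)+ simp
  also have "2 * c * (p x - p y) = 2 * ((p x - p y)\<^sup>2 / (x - y))"
    by (simp add: c_def power2_eq_square)
  also have "c\<^sup>2 * (x - y) = (p x - p y)\<^sup>2 / (x - y)"
    using yx by (simp add: c_def power2_eq_square)
  finally have "(p x - p y)\<^sup>2 / (x - y) \<le> integral {y..x} (\<lambda>z. (p' z)\<^sup>2)" by simp
  also have "\<dots> \<le> integral {l..r} (\<lambda>z. (p' z)\<^sup>2)"
    by (intro integral_subset_le sub integrable_continuous_real continuous_intros c' p') auto
  finally have "(p x - p y)\<^sup>2 \<le> (x - y) * integral {l..r} (\<lambda>z. (p' z)\<^sup>2)"
    using yx by (simp add: field_simps)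
  also have "\<dots> \<le> (r - l) * integral {l..r} (\<lambda>z. (p' z)\<^sup>2)"
    using xy by (intro mult_right_mono integral_nonneg integrable_continuous_real continuous_intros p') auto
  finally show ?thesis .
qed

text \<open>The endpoints form a null set. The differential equations hold only in the open
  interval, so this is the form in which they enter integral estimates.\<close>

lemma has_integral_le_interior:
  fixes p q :: "real \<Rightarrow> real"
  assumes "(p has_integral i) {l..r}" "(q has_integral j) {l..r}"
    and "\<And>x. x \<in> {l<..<r} \<Longrightarrow> p x \<le> q x"
  shows "i \<le> j"
  using has_integral_le[of p i "{l<..<r}" q j] assms by (simp add: has_integral_Icc_iff_Ioo)

text \<open>A nonintegrable function gets the value 0 from \<open>integral\<close>, so the sign is
  available for the energies at every time, in particular at time 0.\<close>

lemma integral_nonneg_real: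
  fixes p :: "real \<Rightarrow> real"
  assumes "\<And>x. 0 \<le> p x"
  shows "0 \<le> integral S p"
  using assms integral_nonneg[of p S] not_integrable_integral[of p S]
  by (cases "p integrable_on S") auto

text \<open>(H + 1) exp(-kt) is nonincreasing. Derivatives are taken in the open interval and only
  continuity is used at the initial time, which is all that the energies of a solution offer
  there.\<close>

lemma gronwall_affine:
  fixes H :: "real \<Rightarrow> real"
  assumes "0 \<le> \<tau>" and c: "continuous_on {0..\<tau>} H"
    and d: "\<And>t. t \<in> {0<..<\<tau>} \<Longrightarrow> \<exists>H'. (H has_real_derivative H') (at t) \<and> H' \<le> k * (H t + 1)"
  shows "H \<tau> + 1 \<le> (H 0 + 1) * exp (k * \<tau>)"
proof -
  have "(\<lambda>t. (H t + 1) * exp (- k * t)) 0 \<ge> (\<lambda>t. (H t + 1) * exp (- k * t)) \<tau>"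
  proof (rule DERIV_nonpos_imp_decreasing_open[where f = "\<lambda>t. (H t + 1) * exp (- k * t)"])
    fix t assume t: "0 < t" "t < \<tau>"
    with d obtain H' where H': "(H has_real_derivative H') (at t)" "H' \<le> k * (H t + 1)"
      by fastforce
    then have "((\<lambda>t. (H t + 1) * exp (- k * t)) has_real_derivative
        (H' - k * (H t + 1)) * exp (- k * t)) (at t)"
      by (auto intro!: derivative_eq_intros simp: algebra_simps)
    then show "\<exists>y. ((\<lambda>t. (H t + 1) * exp (- k * t)) has_real_derivative y) (at t) \<and> y \<le> 0"
      using H' by (auto intro!: exI mult_nonpos_nonneg)
  qed (use assms in \<open>auto intro!: continuous_intros\<close>)
  then have "(H \<tau> + 1) * exp (- k * \<tau>) * exp (k * \<tau>) \<le> (H 0 + 1) * exp (k * \<tau>)"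
    by (intro mult_right_mono) auto
  then show ?thesis by (simp add: mult.assoc flip: exp_add)
qed

text \<open>A first time with \<open>Z s \<ge> K\<close> would exist because the set of such times
  is closed, and \<open>step\<close> rules it out. At \<tau> = 0 the premise of \<open>step\<close>
  is vacuous, so \<open>step\<close> also supplies the initial bound.\<close>

lemma continuity_bootstrap:
  fixes Z :: "real \<Rightarrow> real"
  assumes c: "continuous_on {0..<T} Z"
    and step: "\<And>\<tau>. \<tau> \<in> {0..<T} \<Longrightarrow> (\<And>s. s \<in> {0..<\<tau>} \<Longrightarrow> Z s < K) \<Longrightarrow> Z \<tau> < K"
    and t: "t \<in> {0..<T}"
  shows "Z t < K"
proof (rule ccontr)
  assume "\<not> Z t < K"
  define B where "B = {s\<in>{0..t}. Z s \<ge> K}"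
  have "continuous_on {0..t} Z" using c t by (auto elim: continuous_on_subset)
  then have "closed (Z -` {K..} \<inter> {0..t})"
    by (intro continuous_on_closed_vimage[THEN iffD1, rule_format]) auto
  moreover have "Z -` {K..} \<inter> {0..t} = B" by (auto simp: B_def)
  ultimately have "closed B" by simp
  moreover have "t \<in> B" using \<open>\<not> Z t < K\<close> t by (auto simp: B_def)
  moreover have bb: "bdd_below B" by (auto simp: B_def intro: bdd_belowI[of _ 0])
  ultimately have I: "Inf B \<in> B" using closed_contains_Inf by blast
  have "Z (Inf B) < K"
  proof (rule step)
    show "Inf B \<in> {0..<T}" using I t by (auto simp: B_def)
    show "Z s < K" if "s \<in> {0..<Inf B}" for s
      using that cInf_lower[OF _ bb, of s] I by (force simp: B_def)
  qed
  then show False using I by (simp add: B_def)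
qed

section \<open>Time derivatives of spatial integrals\<close>

text \<open>Tube argument: compactness of \<open>K\<close> makes joint continuity uniform over
  \<open>K\<close> for parameters near \<open>t\<close>.\<close>

lemma uniform_limit_at_parameter:
  fixes g :: "real \<Rightarrow> real \<Rightarrow> real"
  assumes c: "continuous_on (K \<times> J) (\<lambda>(x, t). g x t)" and K: "compact K"
    and J: "open J" "t \<in> J"
  shows "uniform_limit K (\<lambda>s x. g x s) (\<lambda>x. g x t) (nhds t)"
proof (rule uniform_limitI)
  fix e :: real assume e: "e > 0"
  have c': "continuous_on (J \<times> K) (\<lambda>(t, x). g x t)"
    using continuous_on_swap_args[OF c] .
  obtain X where X: "t \<in> X" "open X"
    "\<forall>s\<in>X \<inter> J. \<forall>x\<in>K. dist (case (s, x) of (t, x) \<Rightarrow> g x t) (case (t, x) of (t, x) \<Rightarrow> g x t) \<le> e / 2"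
    using continuous_on_prod_compactE[OF c' K J(2), of "e / 2"] e by auto
  have "\<forall>\<^sub>F s in nhds t. s \<in> X \<inter> J"
    using X J by (intro eventually_nhds_in_open) auto
  then show "\<forall>\<^sub>F s in nhds t. \<forall>x\<in>K. dist (g x s) (g x t) < e"
  proof eventually_elim
    case (elim s)
    then show ?case using X(3) e by (fastforce intro: le_less_trans[of _ "e/2" e])
  qed
qed

text \<open>The derivatives are named as functions of their own, so that one function
  \<open>v\<close> can be the time derivative of \<open>u\<close> and at the same time a function
  with its own derivatives. Space derivatives are one-sided at the endpoints; time derivatives are
  two-sided because the time interval is open.\<close>

definition C21_derivs ::
    "real \<Rightarrow> real \<Rightarrow> real \<Rightarrow> (real \<Rightarrow> real \<Rightarrow> real) \<Rightarrow> (real \<Rightarrow> real \<Rightarrow> real) \<Rightarrow>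
     (real \<Rightarrow> real \<Rightarrow> real) \<Rightarrow> (real \<Rightarrow> real \<Rightarrow> real) \<Rightarrow> bool" where
  "C21_derivs l r T p px pxx pt \<longleftrightarrow>
     (\<forall>x\<in>{l..r}. \<forall>t\<in>{0<..<T}.
        ((\<lambda>y. p y t) has_real_derivative px x t) (at x within {l..r}) \<and>
        ((\<lambda>y. px y t) has_real_derivative pxx x t) (at x within {l..r}) \<and>
        (p x has_real_derivative pt x t) (at t)) \<and>
     continuous_on ({l..r} \<times> {0<..<T}) (\<lambda>(x, t). p x t) \<and>
     continuous_on ({l..r} \<times> {0<..<T}) (\<lambda>(x, t). px x t) \<and>
     continuous_on ({l..r} \<times> {0<..<T}) (\<lambda>(x, t). pxx x t) \<and>
     continuous_on ({l..r} \<times> {0<..<T}) (\<lambda>(x, t). pt x t)"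

lemma continuous_on_slice:
  assumes "continuous_on (K \<times> J) (\<lambda>(x, t). g x t)" "t \<in> J"
  shows "continuous_on K (\<lambda>x. g x t)"
proof -
  have "continuous_on K (\<lambda>x. (x, t))" by (intro continuous_intros)
  then show ?thesis
    using continuous_on_compose2[OF assms(1), of K "\<lambda>x. (x, t)"] assms(2) by auto
qed

lemma
  assumes "C21_derivs l r T p px pxx pt" and "t \<in> {0<..<T}"
  shows C21_derivs_slices: "continuous_on {l..r} (\<lambda>x. p x t)" "continuous_on {l..r} (\<lambda>x. px x t)"
      "continuous_on {l..r} (\<lambda>x. pxx x t)" "continuous_on {l..r} (\<lambda>x. pt x t)"
    and C21_derivs_space:
      "\<And>x. x \<in> {l..r} \<Longrightarrow> ((\<lambda>y. p y t) has_real_derivative px x t) (at x within {l..r})"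
      "\<And>x. x \<in> {l..r} \<Longrightarrow> ((\<lambda>y. px y t) has_real_derivative pxx x t) (at x within {l..r})"
    and C21_derivs_time:
      "\<And>x. x \<in> {l..r} \<Longrightarrow> (p x has_real_derivative pt x t) (at t)"
  using assms by (auto simp: C21_derivs_def intro: continuous_on_slice[of _ "{0<..<T}" p]
      continuous_on_slice[of _ "{0<..<T}" px] continuous_on_slice[of _ "{0<..<T}" pxx]
      continuous_on_slice[of _ "{0<..<T}" pt])

text \<open>By the mean value theorem the quotient is \<open>pt x z\<close> at a time z between s
  and t. This z depends on x, but \<open>pt\<close> is close to its value at t uniformly in
  x.\<close>

lemma difference_quotient_uniform_limit:
  assumes C: "C21_derivs l r T p px pxx pt" and t: "t \<in> {0<..<T}"
  shows "uniform_limit {l..r} (\<lambda>s x. (p x s - p x t) / (s - t)) (\<lambda>x. pt x t) (at t)"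
proof (rule uniform_limitI)
  fix e :: real assume e: "e > 0"
  have c: "continuous_on ({l..r} \<times> {0<..<T}) (\<lambda>(x, t). pt x t)"
    using C by (simp add: C21_derivs_def)
  have "\<forall>\<^sub>F s in nhds t. \<forall>x\<in>{l..r}. dist (pt x s) (pt x t) < e"
    using uniform_limitD[OF uniform_limit_at_parameter[OF c _ _ t] e] by simp
  moreover have "\<forall>\<^sub>F s in nhds t. s \<in> {0<..<T}"
    using t by (intro eventually_nhds_in_open) auto
  ultimately have "\<forall>\<^sub>F s in nhds t. s \<in> {0<..<T} \<and> (\<forall>x\<in>{l..r}. dist (pt x s) (pt x t) < e)"
    by eventually_elim auto
  then obtain d where d: "d > 0"
    "\<And>s. dist s t < d \<Longrightarrow> s \<in> {0<..<T} \<and> (\<forall>x\<in>{l..r}. dist (pt x s) (pt x t) < e)"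
    unfolding eventually_nhds_metric by blast
  have "dist ((p x s - p x t) / (s - t)) (pt x t) < e"
    if s: "s \<noteq> t" "dist s t < d" and x: "x \<in> {l..r}" for s x
  proof -
    have *: "\<exists>z. dist z t < d \<and> p x s - p x t = (s - t) * pt x z"
    proof (cases "t < s")
      case True
      have "\<exists>z>t. z < s \<and> p x s - p x t = (s - t) * pt x z"
        using s True x d(2)
        by (intro MVT2) (auto intro!: C21_derivs_time[OF C] simp: dist_real_def)
      then obtain z where "t < z" "z < s" "p x s - p x t = (s - t) * pt x z" by blast
      then show ?thesis using s by (intro exI[of _ z]) (auto simp: dist_real_def)
    next
      case False
      with s have "s < t" by simp
      have "\<exists>z>s. z < t \<and> p x t - p x s = (t - s) * pt x z"
        using s \<open>s < t\<close> x d(2)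
        by (intro MVT2) (auto intro!: C21_derivs_time[OF C] simp: dist_real_def)
      then obtain z where z: "s < z" "z < t" "p x t - p x s = (t - s) * pt x z" by blast
      have "p x s - p x t = (s - t) * pt x z" using z(3) by (simp add: algebra_simps)
      then show ?thesis using z s by (intro exI[of _ z]) (auto simp: dist_real_def)
    qed
    then obtain z where "dist z t < d" "p x s - p x t = (s - t) * pt x z" by blast
    then show ?thesis using s d(2)[of z] x by simp
  qed
  then show "\<forall>\<^sub>F s in at t. \<forall>x\<in>{l..r}. dist ((p x s - p x t) / (s - t)) (pt x t) < e"
    using d(1) by (auto simp: eventually_at)
qed

text \<open>The mixed derivative of \<open>p\<close> need not exist. The identity
  \<open>\<integral> p\<^sub>x(s)\<^sup>2 - \<integral> p\<^sub>x(t)\<^sup>2 = - \<integral> (p\<^sub>x\<^sub>x(s) + p\<^sub>x\<^sub>x(t)) (p(s) - p(t))\<close>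
  avoids it.\<close>

lemma dirichlet_energy_derivative:
  assumes C: "C21_derivs l r T p px pxx pt" and lr: "l < r" and t: "t \<in> {0<..<T}"
    and bd: "\<And>x. x \<in> {l, r} \<Longrightarrow>
      (\<forall>t\<in>{0<..<T}. px x t = 0) \<or> (\<forall>t\<in>{0<..<T}. p x t = 0)"
  shows "((\<lambda>t. integral {l..r} (\<lambda>x. (px x t)\<^sup>2)) has_real_derivative
           - 2 * integral {l..r} (\<lambda>x. pxx x t * pt x t)) (at t)"
proof -
  define E where "E = (\<lambda>t. integral {l..r} (\<lambda>x. (px x t)\<^sup>2))"
  \<comment> \<open>The value 0 at other times makes every \<open>q s\<close> continuous; the
    theorem on uniform limits under the integral demands this for all s, not only for s near
    t.\<close>
  define q where "q = (\<lambda>s x. if s \<in> {0<..<T} then (pxx x s + pxx x t) * ((p x s - p x t) / (s - t)) else 0)"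
  have ev: "\<forall>\<^sub>F s in at t. s \<in> {0<..<T} \<and> s \<noteq> t"
    using t eventually_at_in_open[of "{0<..<T}" t] by simp
  have diff: "E s - E t = - integral {l..r} (\<lambda>x. (pxx x s + pxx x t) * (p x s - p x t))"
    if s: "s \<in> {0<..<T}" for s
  proof -
    have "E s - E t = integral {l..r} (\<lambda>x. (px x s)\<^sup>2 - (px x t)\<^sup>2)"
      unfolding E_def
      by (intro integral_diff[symmetric] integrable_continuous_real continuous_intros
          C21_derivs_slices[OF C] s t)
    also have "\<dots> = integral {l..r} (\<lambda>x. (px x s + px x t) * (px x s - px x t))"
      by (intro integral_cong) (simp add: power2_eq_square algebra_simps)
    also have "\<dots> = - integral {l..r} (\<lambda>x. (pxx x s + pxx x t) * (p x s - p x t))"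
      using lr bd[of l] bd[of r] s t
      by (intro integral_by_parts_zero)
        (auto intro!: derivative_eq_intros continuous_intros C21_derivs_slices[OF C]
          C21_derivs_space[OF C])
    finally show ?thesis .
  qed
  have cxx: "continuous_on ({l..r} \<times> {0<..<T}) (\<lambda>(x, t). pxx x t)"
    using C by (simp add: C21_derivs_def)
  have bdd: "bounded ((\<lambda>x. pxx x t + pxx x t) ` {l..r})" "bounded ((\<lambda>x. pt x t) ` {l..r})"
    by (intro compact_imp_bounded compact_continuous_image continuous_intros
        C21_derivs_slices[OF C t] compact_Icc)+
  have "uniform_limit {l..r} (\<lambda>s x. pxx x s) (\<lambda>x. pxx x t) (at t)"
    by (rule filterlim_mono[OF uniform_limit_at_parameter[OF cxx _ _ t] order_refl at_within_le_nhds])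
      simp_all
  then have "uniform_limit {l..r} (\<lambda>s x. pxx x s + pxx x t) (\<lambda>x. pxx x t + pxx x t) (at t)"
    by (intro uniform_limit_intros)
  from uniform_lim_mult[OF this difference_quotient_uniform_limit[OF C t] bdd]
  have "uniform_limit {l..r} q (\<lambda>x. (pxx x t + pxx x t) * pt x t) (at t)"
    by (rule uniform_limit_cong[THEN iffD1, rotated -1]) (use ev in \<open>auto simp: q_def elim: eventually_mono\<close>)
  then obtain I I' where I: "\<And>s. (q s has_integral I s) {l..r}"
      "((\<lambda>x. (pxx x t + pxx x t) * pt x t) has_integral I') {l..r}" "(I \<longlongrightarrow> I') (at t)"
  proof (rule uniform_limit_integral)
    show "continuous_on {l..r} (q s)" for s
      unfolding q_def divide_inverse using t
      by (cases "s \<in> {0<..<T}") (auto intro!: continuous_intros C21_derivs_slices[OF C])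
  qed auto
  have "\<forall>\<^sub>F s in at t. - I s = (E s - E t) / (s - t)"
    using ev
  proof eventually_elim
    case (elim s)
    have "I s = integral {l..r} (\<lambda>x. (pxx x s + pxx x t) * (p x s - p x t) / (s - t))"
      using integral_unique[OF I(1)[of s]] elim by (simp add: q_def)
    then show ?case using diff[of s] elim by simp
  qed
  then have "((\<lambda>s. (E s - E t) / (s - t)) \<longlongrightarrow> - I') (at t)"
    using tendsto_minus[OF I(3)] by (rule Lim_transform_eventually[rotated])
  moreover have "- I' = - 2 * integral {l..r} (\<lambda>x. pxx x t * pt x t)"
    using integral_unique[OF I(2)]
    by (simp add: mult.assoc flip: integral_mult_right)
  ultimately show ?thesis
    unfolding E_def has_field_derivative_iff by simp
qed

text \<open>Differentiation under the integral, formulated without \<open>C21_derivs\<close> so that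
  it covers \<open>ux\<close>, about whose time derivative only \<open>mixed_derivative\<close>
  gives information.\<close>

lemma integral_power_derivative:
  fixes p :: "real \<Rightarrow> real \<Rightarrow> real"
  assumes p: "\<And>x t. x \<in> {l..r} \<Longrightarrow> t \<in> {0<..<T} \<Longrightarrow> (p x has_real_derivative pt x t) (at t)"
    and cp: "continuous_on ({l..r} \<times> {0<..<T}) (\<lambda>(x, t). p x t)"
    and cpt: "continuous_on ({l..r} \<times> {0<..<T}) (\<lambda>(x, t). pt x t)"
    and t: "t \<in> {0<..<T}"
  shows "((\<lambda>t. integral {l..r} (\<lambda>x. p x t ^ n)) has_real_derivative
           integral {l..r} (\<lambda>x. real n * p x t ^ (n - 1) * pt x t)) (at t)"
proof -
  have "((\<lambda>t. integral (cbox l r) (\<lambda>x. p x t ^ n)) has_real_derivative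
           integral (cbox l r) (\<lambda>x. real n * p x t ^ (n - 1) * pt x t)) (at t within {0<..<T})"
  proof (rule leibniz_rule_field_derivative)
    show "continuous_on ({0<..<T} \<times> cbox l r) (\<lambda>(t, x). real n * p x t ^ (n - 1) * pt x t)"
      using continuous_on_swap_args[OF cp] continuous_on_swap_args[OF cpt]
      by (auto simp: case_prod_unfold intro!: continuous_intros)
    show "((\<lambda>t. p x t ^ n) has_real_derivative real n * p x s ^ (n - 1) * pt x s)
        (at s within {0<..<T})" if "s \<in> {0<..<T}" "x \<in> cbox l r" for s x
      using DERIV_power[OF has_field_derivative_at_within[OF p], where n = n] that
      by (auto simp: mult_ac)
    show "(\<lambda>x. p x s ^ n) integrable_on cbox l r" if "s \<in> {0<..<T}" for s
      using continuous_on_slice[OF cp that]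
      by (auto intro!: integrable_continuous_real continuous_intros)
  qed (use t in auto)
  then show ?thesis using t at_within_open[of t "{0<..<T}"] by simp
qed

text \<open>The space derivative of \<open>u\<close> is differentiable in time although \<open>u\<^sub>x\<^sub>t\<close> is only defined as
  \<open>(u\<^sub>t)\<^sub>x\<close>: differentiate \<open>u(x,s) = u(x,t\<^sub>0) + \<integral> u\<^sub>t(x,\<tau>) d\<tau>\<close> under the integral.\<close>

lemma mixed_derivative:
  assumes Cu: "C21_derivs l r T u ux uxx v" and Cv: "C21_derivs l r T v vx vxx vt"
    and lr: "l < r" and x: "x \<in> {l..r}" and t: "t \<in> {0<..<T}"
  shows "(ux x has_real_derivative vx x t) (at t)"
proof -
  \<comment> \<open>The base time is positive because \<open>C21_derivs\<close> gives no information
    at time 0.\<close>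
  obtain t0 t1 where tt: "0 < t0" "t0 < t" "t < t1" "t1 < T"
    using t dense[of 0 t] dense[of t T] by auto
  have sub: "{t0..t1} \<subseteq> {0<..<T}" using tt by auto
  have cv: "continuous_on ({l..r} \<times> {0<..<T}) (\<lambda>(x, t). v x t)"
    and cvx: "continuous_on ({l..r} \<times> {0<..<T}) (\<lambda>(x, t). vx x t)"
    using Cv by (auto simp: C21_derivs_def)
  have slice: "continuous_on {t0..s} (v y)" "continuous_on {t0..s} (vx y)"
    if "y \<in> {l..r}" "s \<le> t1" for y s
    using that sub tt
      continuous_on_subset[OF continuous_on_slice[OF continuous_on_swap_args[OF cv], of y], of "{t0..s}"]
      continuous_on_subset[OF continuous_on_slice[OF continuous_on_swap_args[OF cvx], of y], of "{t0..s}"]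
    by (auto simp: subset_iff)
  have u_eq: "u y s = u y t0 + integral {t0..s} (v y)" if "y \<in> {l..r}" "s \<in> {t0..t1}" for y s
  proof -
    have "(v y has_integral u y s - u y t0) {t0..s}"
      using that tt by (intro fundamental_theorem_of_calculus)
        (auto simp flip: has_real_derivative_iff_has_vector_derivative
          intro!: has_field_derivative_at_within[OF C21_derivs_time[OF Cu]])
    then show ?thesis by (simp add: integral_unique)
  qed
  have ux_eq: "ux x s = ux x t0 + integral {t0..s} (vx x)" if s: "s \<in> {t0..t1}" for s
  proof (rule real_derivative_unique_Icc[OF lr x])
    show "((\<lambda>y. u y s) has_real_derivative ux x s) (at x within {l..r})"
      using s tt x by (intro C21_derivs_space[OF Cu]) auto
    have "((\<lambda>y. integral (cbox t0 s) (v y)) has_real_derivative integral (cbox t0 s) (vx x))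
            (at x within {l..r})"
      using s tt x slice
      by (intro leibniz_rule_field_derivative)
        (auto intro!: C21_derivs_space[OF Cv] integrable_continuous_real
          continuous_on_subset[OF cvx])
    then have "((\<lambda>y. u y t0 + integral {t0..s} (v y)) has_real_derivative
        ux x t0 + integral {t0..s} (vx x)) (at x within {l..r})"
      using tt x by (intro DERIV_add C21_derivs_space[OF Cu]) auto
    then show "((\<lambda>y. u y s) has_real_derivative ux x t0 + integral {t0..s} (vx x))
        (at x within {l..r})"
      by (rule has_field_derivative_transform_within[where d = 1]) (use x s in \<open>auto intro: u_eq[symmetric]\<close>)
  qed
  have "((\<lambda>s. integral {t0..s} (vx x)) has_real_derivative vx x t) (at t within {t0..t1})"
    using tt x slice by (intro integral_has_real_derivative) auto
  then have "((\<lambda>s. ux x t0 + integral {t0..s} (vx x)) has_real_derivative vx x t)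
      (at t within {t0..t1})"
    by (auto intro!: derivative_eq_intros)
  then have "(ux x has_real_derivative vx x t) (at t within {t0..t1})"
    by (rule has_field_derivative_transform_within[where d = 1]) (use tt in \<open>auto intro: ux_eq[symmetric]\<close>)
  then show ?thesis using tt by (simp add: at_within_Icc_at)
qed

section \<open>Energy estimates\<close>

lemma young:
  fixes p q :: real
  assumes "e > 0"
  shows "- 2 * p * q \<le> e * p\<^sup>2 + q\<^sup>2 / e"
proof -
  have "0 \<le> (e * p + q)\<^sup>2 / e" using assms by simp
  also have "\<dots> = e * p\<^sup>2 + q\<^sup>2 / e + 2 * p * q"
    using assms by (simp add: power2_eq_square field_simps)
  finally show ?thesis by simp
qed

lemma sum_square_le:
  fixes p q :: real
  shows "(p + q)\<^sup>2 \<le> 2 * p\<^sup>2 + 2 * q\<^sup>2"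
  using sum_squares_bound[of p q] by (simp add: power2_sum)

text \<open>Here \<open>gv\<close>, \<open>g1\<close>, \<open>f1\<close>, \<open>tx\<close> stand
  for \<gamma>(\<theta>), \<gamma>'(\<theta>), f'(\<theta>) and the slope of \<theta>. Ellipticity
  yields 2m times the square of \<open>wxx\<close>; the terms with \<gamma>' and f' use up m/2 and
  m/4 of it, so 5m/4 remains.\<close>

lemma strain_pointwise:
  fixes wxx gv g1 f1 tx wx S \<delta> m :: real
  assumes "m > 0" "m \<le> gv" "\<bar>g1\<bar> \<le> \<delta>" "\<bar>f1\<bar> \<le> \<delta>" "wx\<^sup>2 \<le> S"
  shows "- 2 * (wxx * (gv * wxx + g1 * tx * wx + f1 * tx))
    \<le> - (5 / 4) * m * wxx\<^sup>2 + (2 * \<delta>\<^sup>2 * S / m + 4 * \<delta>\<^sup>2 / m) * tx\<^sup>2"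
proof -
  have g1: "g1\<^sup>2 \<le> \<delta>\<^sup>2" and f1: "f1\<^sup>2 \<le> \<delta>\<^sup>2" using power_mono[OF assms(3), of 2] power_mono[OF assms(4), of 2] by simp_all
  have 1: "- 2 * (wxx * (gv * wxx)) \<le> - 2 * m * wxx\<^sup>2"
    using mult_right_mono[OF assms(2), of "wxx\<^sup>2"] by (simp add: power2_eq_square mult_ac)
  have "- 2 * wxx * (g1 * tx * wx) \<le> (m / 2) * wxx\<^sup>2 + (g1 * tx * wx)\<^sup>2 / (m / 2)"
    using assms(1) by (intro young) simp
  moreover have "(g1 * tx * wx)\<^sup>2 \<le> \<delta>\<^sup>2 * S * tx\<^sup>2"
    using mult_right_mono[OF mult_mono[OF g1 assms(5)], of "tx\<^sup>2"]
    by (simp add: power_mult_distrib mult_ac)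
  ultimately have 2: "- 2 * wxx * (g1 * tx * wx) \<le> (m / 2) * wxx\<^sup>2 + \<delta>\<^sup>2 * S * tx\<^sup>2 / (m / 2)"
    using assms(1) by (smt (verit) divide_right_mono half_gt_zero)
  have "- 2 * wxx * (f1 * tx) \<le> (m / 4) * wxx\<^sup>2 + (f1 * tx)\<^sup>2 / (m / 4)"
    using assms(1) by (intro young) simp
  moreover have "(f1 * tx)\<^sup>2 \<le> \<delta>\<^sup>2 * tx\<^sup>2"
    using mult_right_mono[OF f1, of "tx\<^sup>2"] by (simp add: power_mult_distrib)
  ultimately have 3: "- 2 * wxx * (f1 * tx) \<le> (m / 4) * wxx\<^sup>2 + \<delta>\<^sup>2 * tx\<^sup>2 / (m / 4)"
    using assms(1) by (smt (verit) divide_right_mono zero_le_divide_iff)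
  have "- 2 * (wxx * (gv * wxx + g1 * tx * wx + f1 * tx))
      = - 2 * (wxx * (gv * wxx)) + - 2 * wxx * (g1 * tx * wx) + - 2 * wxx * (f1 * tx)"
    by (simp add: algebra_simps)
  also have "\<dots> \<le> - 2 * m * wxx\<^sup>2 + ((m / 2) * wxx\<^sup>2 + \<delta>\<^sup>2 * S * tx\<^sup>2 / (m / 2))
      + ((m / 4) * wxx\<^sup>2 + \<delta>\<^sup>2 * tx\<^sup>2 / (m / 4))"
    by (intro add_mono 1 2 3)
  also have "\<dots> = - (5 / 4) * m * wxx\<^sup>2 + (2 * \<delta>\<^sup>2 * S / m + 4 * \<delta>\<^sup>2 / m) * tx\<^sup>2"
    using assms(1) by (simp add: field_simps)
  finally show ?thesis .
qed

text \<open>The strain rate is written as \<open>wx - a * ux\<close>. Its fourth power produces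
  wx^4, reduced to S wx^2 by the supremum bound, and ux^4, which is why the quartic energy of
  \<open>ux\<close> has to be followed as well.\<close>

lemma heat_pointwise:
  fixes txx Gv Fv th wx ux a S R D C b :: real
  assumes "D > 0" "0 \<le> Gv" "Gv \<le> b" "\<bar>Fv\<bar> \<le> C * (1 + th)" "wx\<^sup>2 \<le> S" "th\<^sup>2 \<le> R"
  shows "- 2 * (txx * (D * txx + Gv * (wx - a * ux)\<^sup>2 + Fv * (wx - a * ux)))
    \<le> (8 * b\<^sup>2 * S / D) * wx\<^sup>2 + (8 * b\<^sup>2 * a ^ 4 / D) * ux ^ 4
      + (4 * C\<^sup>2 * (1 + R) / D) * wx\<^sup>2 + (4 * C\<^sup>2 * (1 + R) / D * a\<^sup>2) * ux\<^sup>2"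
proof -
  define y where "y = wx - a * ux"
  define P where "P = Gv * y\<^sup>2 + Fv * y"
  have y2: "y\<^sup>2 \<le> 2 * wx\<^sup>2 + 2 * a\<^sup>2 * ux\<^sup>2"
    using sum_square_le[of wx "- (a * ux)"] by (simp add: y_def power_mult_distrib)
  have "y ^ 4 \<le> (2 * wx\<^sup>2 + 2 * a\<^sup>2 * ux\<^sup>2)\<^sup>2"
    using power_mono[OF y2, of 2] by (simp flip: power_mult)
  also have "\<dots> \<le> 2 * (2 * wx\<^sup>2)\<^sup>2 + 2 * (2 * a\<^sup>2 * ux\<^sup>2)\<^sup>2" by (rule sum_square_le)
  also have "\<dots> = 8 * (wx\<^sup>2 * wx\<^sup>2) + 8 * a ^ 4 * ux ^ 4"
    by (simp add: power_mult_distrib flip: power_mult power_add)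
  also have "\<dots> \<le> 8 * (S * wx\<^sup>2) + 8 * a ^ 4 * ux ^ 4"
    using mult_right_mono[OF assms(5), of "wx\<^sup>2"] by simp
  finally have y4: "y ^ 4 \<le> 8 * (S * wx\<^sup>2) + 8 * a ^ 4 * ux ^ 4" .
  have "(C * (1 + th))\<^sup>2 \<le> C\<^sup>2 * (2 + 2 * R)"
    using sum_square_le[of 1 th] assms(6) by (auto simp: power_mult_distrib intro!: mult_left_mono)
  then have F2: "Fv\<^sup>2 \<le> C\<^sup>2 * (2 + 2 * R)"
    using assms(4) power_mono[of "\<bar>Fv\<bar>" "C * (1 + th)" 2] by simp
  have G2: "Gv\<^sup>2 \<le> b\<^sup>2" using assms by (intro power_mono) auto
  have R0: "0 \<le> R" using assms(6) zero_le_power2 order_trans by blast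
  have "P\<^sup>2 \<le> 2 * (Gv * y\<^sup>2)\<^sup>2 + 2 * (Fv * y)\<^sup>2" unfolding P_def by (rule sum_square_le)
  also have "\<dots> = 2 * (Gv\<^sup>2 * y ^ 4) + 2 * (Fv\<^sup>2 * y\<^sup>2)"
    by (simp add: power_mult_distrib flip: power_mult)
  also have "\<dots> \<le> 2 * (b\<^sup>2 * (8 * (S * wx\<^sup>2) + 8 * a ^ 4 * ux ^ 4))
      + 2 * ((C\<^sup>2 * (2 + 2 * R)) * (2 * wx\<^sup>2 + 2 * a\<^sup>2 * ux\<^sup>2))"
    using R0 by (intro add_mono mult_left_mono mult_mono G2 y4 F2 y2) auto
  finally have P2: "P\<^sup>2 \<le> \<dots>" .
  \<comment> \<open>The weight \<open>2 * D\<close> spends the whole diffusion term, since no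
    dissipation of \<theta> is used later.\<close>
  have "- 2 * txx * P \<le> (2 * D) * txx\<^sup>2 + P\<^sup>2 / (2 * D)" using assms(1) by (intro young) simp
  then have "- 2 * (txx * (D * txx + Gv * y\<^sup>2 + Fv * y)) \<le> P\<^sup>2 / (2 * D)"
    by (simp add: P_def power2_eq_square algebra_simps)
  also have "\<dots> \<le> (2 * (b\<^sup>2 * (8 * (S * wx\<^sup>2) + 8 * a ^ 4 * ux ^ 4))
      + 2 * ((C\<^sup>2 * (2 + 2 * R)) * (2 * wx\<^sup>2 + 2 * a\<^sup>2 * ux\<^sup>2))) / (2 * D)"
    using assms(1) P2 by (intro divide_right_mono) auto
  also have "\<dots> = (8 * b\<^sup>2 * S / D) * wx\<^sup>2 + (8 * b\<^sup>2 * a ^ 4 / D) * ux ^ 4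
      + (4 * C\<^sup>2 * (1 + R) / D) * wx\<^sup>2 + (4 * C\<^sup>2 * (1 + R) / D * a\<^sup>2) * ux\<^sup>2"
    using assms(1) by (simp add: field_simps)
  finally show ?thesis by (simp add: y_def)
qed

lemma quartic_pointwise:
  fixes ux wx a S :: real
  assumes "a > 0" "wx\<^sup>2 \<le> S"
  shows "4 * ux ^ 3 * (wx - a * ux) \<le> 3 * ux ^ 4 + S * wx\<^sup>2"
proof -
  \<comment> \<open>Sum-of-squares certificate for 4 p^3 q \<le> 3 p^4 + q^4. The damping term -4 a
    ux^4 has a good sign and is dropped below.\<close>
  have "0 \<le> (ux - wx)\<^sup>2 * ((ux + wx)\<^sup>2 + 2 * ux\<^sup>2)" by simp
  also have "\<dots> = 3 * ux ^ 4 + wx\<^sup>2 * wx\<^sup>2 - 4 * ux ^ 3 * wx"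
    by (simp add: power2_eq_square power3_eq_cube power4_eq_xxxx algebra_simps)
  finally have "4 * ux ^ 3 * wx \<le> 3 * ux ^ 4 + wx\<^sup>2 * wx\<^sup>2" by simp
  moreover have "4 * ux ^ 3 * (wx - a * ux) = 4 * ux ^ 3 * wx - 4 * a * ux ^ 4"
    by (simp add: power3_eq_cube power4_eq_xxxx algebra_simps)
  moreover have "wx\<^sup>2 * wx\<^sup>2 \<le> S * wx\<^sup>2" using assms(2) by (intro mult_right_mono) auto
  moreover have "0 \<le> 4 * a * ux ^ 4" using assms(1) by simp
  ultimately show ?thesis by linarith
qed

text \<open>A classical solution on (0,T) with the momentum equation already expanded by the product
  and chain rules. Up to time 0 only the first space derivatives are continuous, as the parabolic
  Holder spaces provide; they suffice to start Gronwall at the initial data.\<close>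

locale thermoviscoelastic =
  fixes l r T a D \<delta> \<gamma>lo \<gamma>hi C :: real
    and g g' f f' G F :: "real \<Rightarrow> real"
    and u ux uxx v vx vxx vt \<theta> \<theta>x \<theta>xx \<theta>t :: "real \<Rightarrow> real \<Rightarrow> real"
  assumes lr: "l < r" and T: "0 < T" and a: "0 < a" and D: "0 < D" and \<gamma>lo: "0 < \<gamma>lo"
    and u: "C21_derivs l r T u ux uxx v"
    and v: "C21_derivs l r T v vx vxx vt"
    and \<theta>: "C21_derivs l r T \<theta> \<theta>x \<theta>xx \<theta>t"
    and cont: "continuous_on ({l..r} \<times> {0..<T}) (\<lambda>(x, t). ux x t)"
      "continuous_on ({l..r} \<times> {0..<T}) (\<lambda>(x, t). vx x t)"
      "continuous_on ({l..r} \<times> {0..<T}) (\<lambda>(x, t). \<theta>x x t)"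
    and neumann: "\<And>x t. x \<in> {l, r} \<Longrightarrow> t \<in> {0<..<T} \<Longrightarrow> ux x t = 0"
    and dirichlet: "\<And>x t. x \<in> {l, r} \<Longrightarrow> t \<in> {0<..<T} \<Longrightarrow> \<theta> x t = 0"
    and \<theta>_nonneg: "\<And>x t. x \<in> {l..r} \<Longrightarrow> t \<in> {0<..<T} \<Longrightarrow> 0 \<le> \<theta> x t"
    and g: "\<And>s. s \<ge> 0 \<Longrightarrow> (g has_real_derivative g' s) (at s within {0..})"
    and f: "\<And>s. s \<ge> 0 \<Longrightarrow> (f has_real_derivative f' s) (at s within {0..})"
    and coeff_bounds: "\<And>s. s \<ge> 0 \<Longrightarrow> \<gamma>lo \<le> g s" "\<And>s. s \<ge> 0 \<Longrightarrow> \<bar>g' s\<bar> \<le> \<delta>"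
      "\<And>s. s \<ge> 0 \<Longrightarrow> \<bar>f' s\<bar> \<le> \<delta>" "\<And>s. s \<ge> 0 \<Longrightarrow> 0 \<le> G s \<and> G s \<le> \<gamma>hi"
      "\<And>s. s \<ge> 0 \<Longrightarrow> \<bar>F s\<bar> \<le> C * (1 + s)"
    and momentum: "\<And>x t. x \<in> {l<..<r} \<Longrightarrow> t \<in> {0<..<T} \<Longrightarrow>
      vt x t = g (\<theta> x t) * (vxx x t + a * uxx x t)
        + g' (\<theta> x t) * \<theta>x x t * (vx x t + a * ux x t) + f' (\<theta> x t) * \<theta>x x t"
    and heat: "\<And>x t. x \<in> {l<..<r} \<Longrightarrow> t \<in> {0<..<T} \<Longrightarrow>
      \<theta>t x t = D * \<theta>xx x t + G (\<theta> x t) * (vx x t)\<^sup>2 + F (\<theta> x t) * vx x t"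
begin

text \<open>No second derivative of \<open>u\<close> remains in the equation for \<open>w\<close>, because both elastic terms
  carry the same coefficient \<open>\<gamma>(\<theta>)\<close>.\<close>

definition "w x t = v x t + a * u x t"
definition "wx x t = vx x t + a * ux x t"
definition "wxx x t = vxx x t + a * uxx x t"
definition "L = r - l"
definition "w_energy t = integral {l..r} (\<lambda>x. (wx x t)\<^sup>2)"
definition "u_energy t = integral {l..r} (\<lambda>x. (ux x t)\<^sup>2)"
definition "u_quartic t = integral {l..r} (\<lambda>x. ux x t ^ 4)"
definition "\<theta>_energy t = integral {l..r} (\<lambda>x. (\<theta>x x t)\<^sup>2)"
definition "w_dissipation t = integral {l..r} (\<lambda>x. (wxx x t)\<^sup>2)"

section \<open>Regularity, boundary values and supremum bounds of the solution\<close>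

lemma L_pos: "0 < L" using lr by (simp add: L_def)

lemma w: "C21_derivs l r T w wx wxx (\<lambda>x t. vt x t + a * v x t)"
  using u v unfolding C21_derivs_def w_def wx_def wxx_def
  by (auto simp: case_prod_unfold intro!: derivative_eq_intros continuous_intros)

lemmas slices [continuous_intros] =
  C21_derivs_slices[OF u] C21_derivs_slices[OF v] C21_derivs_slices[OF \<theta>]
  C21_derivs_slices[OF w]

lemma ux_time: "x \<in> {l..r} \<Longrightarrow> t \<in> {0<..<T} \<Longrightarrow> (ux x has_real_derivative vx x t) (at t)"
  by (rule mixed_derivative[OF u v lr])

text \<open>The Neumann condition is differentiated in time: \<open>vx x\<close> is the derivative
  of \<open>ux x\<close>, which vanishes identically on (0,T).\<close>

lemma vx_boundary:
  assumes "x \<in> {l, r}" "t \<in> {0<..<T}"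
  shows "vx x t = 0"
proof (rule DERIV_unique)
  show "(ux x has_real_derivative vx x t) (at t)" using assms lr by (intro ux_time) auto
  have "((\<lambda>_. 0 :: real) has_real_derivative 0) (at t)" by simp
  then show "(ux x has_real_derivative 0) (at t)"
    by (rule has_field_derivative_transform_within_open[where S = "{0<..<T}"])
      (use assms neumann in auto)
qed

lemma wx_boundary: "x \<in> {l, r} \<Longrightarrow> t \<in> {0<..<T} \<Longrightarrow> wx x t = 0"
  by (simp add: wx_def vx_boundary neumann)

lemma has_integrals:
  assumes "t \<in> {0<..<T}"
  shows "((\<lambda>x. (wx x t)\<^sup>2) has_integral w_energy t) {l..r}"
    "((\<lambda>x. (ux x t)\<^sup>2) has_integral u_energy t) {l..r}"
    "((\<lambda>x. ux x t ^ 4) has_integral u_quartic t) {l..r}"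
    "((\<lambda>x. (\<theta>x x t)\<^sup>2) has_integral \<theta>_energy t) {l..r}"
    "((\<lambda>x. (wxx x t)\<^sup>2) has_integral w_dissipation t) {l..r}"
  unfolding w_energy_def u_energy_def u_quartic_def \<theta>_energy_def w_dissipation_def
  by (intro integrable_integral integrable_continuous_real continuous_intros assms)+

lemma energies_nonneg:
  "0 \<le> w_energy t" "0 \<le> u_energy t" "0 \<le> u_quartic t" "0 \<le> \<theta>_energy t"
  "0 \<le> w_dissipation t"
  by (auto simp: w_energy_def u_energy_def u_quartic_def \<theta>_energy_def w_dissipation_def
      intro!: integral_nonneg_real)

lemma wx_square_le: "x \<in> {l..r} \<Longrightarrow> t \<in> {0<..<T} \<Longrightarrow> (wx x t)\<^sup>2 \<le> L * w_dissipation t"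
  using square_le_integral_deriv_square[where p = "\<lambda>x. wx x t" and p' = "\<lambda>x. wxx x t"
      and l = l and r = r and y = l and x = x] wx_boundary[of l t] lr
    C21_derivs_space(2)[OF w] C21_derivs_slices(3)[OF w]
  by (auto simp: L_def w_dissipation_def)

lemma \<theta>_square_le: "x \<in> {l..r} \<Longrightarrow> t \<in> {0<..<T} \<Longrightarrow> (\<theta> x t)\<^sup>2 \<le> L * \<theta>_energy t"
  using square_le_integral_deriv_square[where p = "\<lambda>x. \<theta> x t" and p' = "\<lambda>x. \<theta>x x t"
      and l = l and r = r and y = l and x = x] dirichlet[of l t] lr
    C21_derivs_space(1)[OF \<theta>] C21_derivs_slices(2)[OF \<theta>]
  by (auto simp: L_def \<theta>_energy_def)

section \<open>Differential inequality for each energy\<close>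

lemma w_energy_derivative:
  assumes t: "t \<in> {0<..<T}"
  shows "\<exists>d. (w_energy has_real_derivative d) (at t) \<and>
    d \<le> - (5 / 4) * \<gamma>lo * w_dissipation t + (2 * \<delta>\<^sup>2 * (L * w_dissipation t) / \<gamma>lo + 4 * \<delta>\<^sup>2 / \<gamma>lo) * \<theta>_energy t
      + (2 * a + a\<^sup>2) * w_energy t + a\<^sup>2 * u_energy t"
proof (intro exI conjI)
  show "(w_energy has_real_derivative - 2 * integral {l..r} (\<lambda>x. wxx x t * (vt x t + a * v x t))) (at t)"
    unfolding w_energy_def using wx_boundary
    by (intro dirichlet_energy_derivative[OF w lr t]) auto
  \<comment> \<open>The time derivative of \<open>w\<close> is \<open>vt + a * v\<close>. Only the
    part with \<open>vt\<close> is treated by the equation; for \<open>a * v\<close> one derivative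
    is moved back, which leaves a product of first derivatives.\<close>
  have parts: "integral {l..r} (\<lambda>x. wx x t * vx x t) = - integral {l..r} (\<lambda>x. wxx x t * v x t)"
    using lr wx_boundary t
    by (intro integral_by_parts_zero)
      (auto intro!: C21_derivs_space[OF w] C21_derivs_space[OF v] continuous_intros)
  have split: "integral {l..r} (\<lambda>x. wxx x t * (vt x t + a * v x t))
      = (integral {l..r} (\<lambda>x. wxx x t * vt x t) + a * integral {l..r} (\<lambda>x. wxx x t * v x t))"
    by (subst integral_mult_right[symmetric], subst integral_add[symmetric])
      (auto intro!: integrable_continuous_real continuous_intros t simp: algebra_simps)
  have 1: "- 2 * integral {l..r} (\<lambda>x. wxx x t * vt x t)
      \<le> - (5 / 4) * \<gamma>lo * w_dissipation t + (2 * \<delta>\<^sup>2 * (L * w_dissipation t) / \<gamma>lo + 4 * \<delta>\<^sup>2 / \<gamma>lo) * \<theta>_energy t"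
  proof (rule has_integral_le_interior)
    show "((\<lambda>x. - 2 * (wxx x t * vt x t)) has_integral - 2 * integral {l..r} (\<lambda>x. wxx x t * vt x t)) {l..r}"
      by (intro has_integral_mult_right integrable_integral integrable_continuous_real continuous_intros t)
    show "((\<lambda>x. - (5 / 4) * \<gamma>lo * (wxx x t)\<^sup>2
          + (2 * \<delta>\<^sup>2 * (L * w_dissipation t) / \<gamma>lo + 4 * \<delta>\<^sup>2 / \<gamma>lo) * (\<theta>x x t)\<^sup>2) has_integral
        - (5 / 4) * \<gamma>lo * w_dissipation t + (2 * \<delta>\<^sup>2 * (L * w_dissipation t) / \<gamma>lo + 4 * \<delta>\<^sup>2 / \<gamma>lo) * \<theta>_energy t) {l..r}"
      by (intro has_integral_add has_integral_mult_right has_integrals t)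
    fix x assume x: "x \<in> {l<..<r}"
    then have th: "0 \<le> \<theta> x t" using \<theta>_nonneg t by simp
    show "- 2 * (wxx x t * vt x t) \<le> - (5 / 4) * \<gamma>lo * (wxx x t)\<^sup>2
        + (2 * \<delta>\<^sup>2 * (L * w_dissipation t) / \<gamma>lo + 4 * \<delta>\<^sup>2 / \<gamma>lo) * (\<theta>x x t)\<^sup>2"
      using strain_pointwise[OF \<gamma>lo coeff_bounds(1,2,3)[OF th] wx_square_le[of x t],
          of "wxx x t" "\<theta>x x t"] x t
      by (simp add: momentum wxx_def wx_def)
  qed
  have 2: "2 * a * integral {l..r} (\<lambda>x. wx x t * vx x t) \<le> (2 * a + a\<^sup>2) * w_energy t + a\<^sup>2 * u_energy t"
  proof (rule has_integral_le_interior)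
    show "((\<lambda>x. 2 * a * (wx x t * vx x t)) has_integral 2 * a * integral {l..r} (\<lambda>x. wx x t * vx x t)) {l..r}"
      by (intro has_integral_mult_right integrable_integral integrable_continuous_real continuous_intros t)
    show "((\<lambda>x. (2 * a + a\<^sup>2) * (wx x t)\<^sup>2 + a\<^sup>2 * (ux x t)\<^sup>2) has_integral
        (2 * a + a\<^sup>2) * w_energy t + a\<^sup>2 * u_energy t) {l..r}"
      by (intro has_integral_add has_integral_mult_right has_integrals t)
    fix x
    \<comment> \<open>This square controls the mixed term that arises from
      \<open>vx = wx - a * ux\<close>.\<close>
    have "0 \<le> a\<^sup>2 * (wx x t + ux x t)\<^sup>2" by simp
    then show "2 * a * (wx x t * vx x t) \<le> (2 * a + a\<^sup>2) * (wx x t)\<^sup>2 + a\<^sup>2 * (ux x t)\<^sup>2"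
      by (simp add: wx_def power2_eq_square algebra_simps)
  qed
  show "- 2 * integral {l..r} (\<lambda>x. wxx x t * (vt x t + a * v x t))
      \<le> - (5 / 4) * \<gamma>lo * w_dissipation t + (2 * \<delta>\<^sup>2 * (L * w_dissipation t) / \<gamma>lo + 4 * \<delta>\<^sup>2 / \<gamma>lo) * \<theta>_energy t
        + (2 * a + a\<^sup>2) * w_energy t + a\<^sup>2 * u_energy t"
    using 1 2 unfolding split parts by (simp add: algebra_simps)
qed

lemma ux_power_derivative:
  assumes t: "t \<in> {0<..<T}"
  shows "((\<lambda>t. integral {l..r} (\<lambda>x. ux x t ^ n)) has_real_derivative
           integral {l..r} (\<lambda>x. real n * ux x t ^ (n - 1) * vx x t)) (at t)"
  using u v t unfolding C21_derivs_def by (intro integral_power_derivative ux_time) auto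

lemma u_energy_derivative:
  assumes t: "t \<in> {0<..<T}"
  shows "\<exists>d. (u_energy has_real_derivative d) (at t) \<and> d \<le> u_energy t + w_energy t"
proof (intro exI conjI)
  show "(u_energy has_real_derivative integral {l..r} (\<lambda>x. 2 * ux x t * vx x t)) (at t)"
    using ux_power_derivative[OF t, of 2] by (simp add: u_energy_def[abs_def])
  show "integral {l..r} (\<lambda>x. 2 * ux x t * vx x t) \<le> u_energy t + w_energy t"
  proof (rule has_integral_le_interior)
    show "((\<lambda>x. 2 * ux x t * vx x t) has_integral integral {l..r} (\<lambda>x. 2 * ux x t * vx x t)) {l..r}"
      by (intro integrable_integral integrable_continuous_real continuous_intros t)
    show "((\<lambda>x. (ux x t)\<^sup>2 + (wx x t)\<^sup>2) has_integral u_energy t + w_energy t) {l..r}"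
      by (intro has_integral_add has_integrals t)
    fix x
    \<comment> \<open>With \<open>vx = wx - a * ux\<close> the square handles the mixed product, and
      the remaining term is damping.\<close>
    have "0 \<le> (ux x t - wx x t)\<^sup>2" "0 \<le> a * (ux x t)\<^sup>2" using a by simp_all
    then show "2 * ux x t * vx x t \<le> (ux x t)\<^sup>2 + (wx x t)\<^sup>2"
      by (simp add: wx_def power2_eq_square algebra_simps)
  qed
qed

lemma u_quartic_derivative:
  assumes t: "t \<in> {0<..<T}"
  shows "\<exists>d. (u_quartic has_real_derivative d) (at t) \<and> d \<le> 3 * u_quartic t + L * w_dissipation t * w_energy t"
proof (intro exI conjI)
  show "(u_quartic has_real_derivative integral {l..r} (\<lambda>x. 4 * ux x t ^ 3 * vx x t)) (at t)"
    using ux_power_derivative[OF t, of 4] by (simp add: u_quartic_def[abs_def])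
  show "integral {l..r} (\<lambda>x. 4 * ux x t ^ 3 * vx x t) \<le> 3 * u_quartic t + L * w_dissipation t * w_energy t"
  proof (rule has_integral_le_interior)
    show "((\<lambda>x. 4 * ux x t ^ 3 * vx x t) has_integral integral {l..r} (\<lambda>x. 4 * ux x t ^ 3 * vx x t)) {l..r}"
      by (intro integrable_integral integrable_continuous_real continuous_intros t)
    show "((\<lambda>x. 3 * ux x t ^ 4 + L * w_dissipation t * (wx x t)\<^sup>2) has_integral 3 * u_quartic t + L * w_dissipation t * w_energy t) {l..r}"
      by (intro has_integral_add has_integral_mult_right has_integrals t)
    fix x assume x: "x \<in> {l<..<r}"
    show "4 * ux x t ^ 3 * vx x t \<le> 3 * ux x t ^ 4 + L * w_dissipation t * (wx x t)\<^sup>2"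
      using quartic_pointwise[OF a wx_square_le[of x t], of "ux x t"] x t by (simp add: wx_def)
  qed
qed

lemma \<theta>_energy_derivative:
  assumes t: "t \<in> {0<..<T}"
  shows "\<exists>d. (\<theta>_energy has_real_derivative d) (at t) \<and>
    d \<le> (8 * \<gamma>hi\<^sup>2 * (L * w_dissipation t) / D) * w_energy t + (8 * \<gamma>hi\<^sup>2 * a ^ 4 / D) * u_quartic t
      + (4 * C\<^sup>2 * (1 + L * \<theta>_energy t) / D) * w_energy t + (4 * C\<^sup>2 * (1 + L * \<theta>_energy t) / D * a\<^sup>2) * u_energy t"
proof (intro exI conjI)
  show "(\<theta>_energy has_real_derivative - 2 * integral {l..r} (\<lambda>x. \<theta>xx x t * \<theta>t x t)) (at t)"
    unfolding \<theta>_energy_def using dirichlet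
    by (intro dirichlet_energy_derivative[OF \<theta> lr t]) auto
  show "- 2 * integral {l..r} (\<lambda>x. \<theta>xx x t * \<theta>t x t)
    \<le> (8 * \<gamma>hi\<^sup>2 * (L * w_dissipation t) / D) * w_energy t + (8 * \<gamma>hi\<^sup>2 * a ^ 4 / D) * u_quartic t
      + (4 * C\<^sup>2 * (1 + L * \<theta>_energy t) / D) * w_energy t + (4 * C\<^sup>2 * (1 + L * \<theta>_energy t) / D * a\<^sup>2) * u_energy t"
  proof (rule has_integral_le_interior)
    show "((\<lambda>x. - 2 * (\<theta>xx x t * \<theta>t x t)) has_integral - 2 * integral {l..r} (\<lambda>x. \<theta>xx x t * \<theta>t x t)) {l..r}"
      by (intro has_integral_mult_right integrable_integral integrable_continuous_real continuous_intros t)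
    show "((\<lambda>x. (8 * \<gamma>hi\<^sup>2 * (L * w_dissipation t) / D) * (wx x t)\<^sup>2 + (8 * \<gamma>hi\<^sup>2 * a ^ 4 / D) * ux x t ^ 4
      + (4 * C\<^sup>2 * (1 + L * \<theta>_energy t) / D) * (wx x t)\<^sup>2 + (4 * C\<^sup>2 * (1 + L * \<theta>_energy t) / D * a\<^sup>2) * (ux x t)\<^sup>2)
      has_integral (8 * \<gamma>hi\<^sup>2 * (L * w_dissipation t) / D) * w_energy t + (8 * \<gamma>hi\<^sup>2 * a ^ 4 / D) * u_quartic t
      + (4 * C\<^sup>2 * (1 + L * \<theta>_energy t) / D) * w_energy t + (4 * C\<^sup>2 * (1 + L * \<theta>_energy t) / D * a\<^sup>2) * u_energy t) {l..r}"
      by (intro has_integral_add has_integral_mult_right has_integrals t)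
    fix x assume x: "x \<in> {l<..<r}"
    then have th: "0 \<le> \<theta> x t" using \<theta>_nonneg t by simp
    show "- 2 * (\<theta>xx x t * \<theta>t x t)
      \<le> (8 * \<gamma>hi\<^sup>2 * (L * w_dissipation t) / D) * (wx x t)\<^sup>2 + (8 * \<gamma>hi\<^sup>2 * a ^ 4 / D) * ux x t ^ 4
      + (4 * C\<^sup>2 * (1 + L * \<theta>_energy t) / D) * (wx x t)\<^sup>2 + (4 * C\<^sup>2 * (1 + L * \<theta>_energy t) / D * a\<^sup>2) * (ux x t)\<^sup>2"
      using heat_pointwise[OF D coeff_bounds(4)[OF th, THEN conjunct1] coeff_bounds(4)[OF th, THEN conjunct2]
          coeff_bounds(5)[OF th] wx_square_le[of x t] \<theta>_square_le[of x t],
          of "\<theta>xx x t" a "ux x t"] x t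
      by (simp add: heat wx_def)
  qed
qed

section \<open>Combined energies and a priori bounds\<close>

lemma energies_continuous:
  "continuous_on {0..<T} w_energy" "continuous_on {0..<T} u_energy"
  "continuous_on {0..<T} u_quartic" "continuous_on {0..<T} \<theta>_energy"
proof -
  have c: "continuous_on {0..<T} (\<lambda>t. integral (cbox l r) (\<lambda>x. p x t ^ n))"
    if "continuous_on ({l..r} \<times> {0..<T}) (\<lambda>(x, t). p x t)" for p :: "real \<Rightarrow> real \<Rightarrow> real" and n
    using continuous_on_swap_args[OF that]
    by (intro integral_continuous_on_param) (auto simp: case_prod_unfold intro!: continuous_intros)
  have "continuous_on ({l..r} \<times> {0..<T}) (\<lambda>(x, t). wx x t)"
    using cont by (auto simp: case_prod_unfold wx_def intro!: continuous_intros)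
  from c[OF this, of 2] show "continuous_on {0..<T} w_energy" by (simp add: w_energy_def[abs_def])
  from c[OF cont(1), of 2] show "continuous_on {0..<T} u_energy" by (simp add: u_energy_def[abs_def])
  from c[OF cont(1), of 4] show "continuous_on {0..<T} u_quartic" by (simp add: u_quartic_def[abs_def])
  from c[OF cont(3), of 2] show "continuous_on {0..<T} \<theta>_energy" by (simp add: \<theta>_energy_def[abs_def])
qed

text \<open>The smallness threshold is chosen so that the \<gamma>' term costs exactly a quarter of
  \<open>\<gamma>lo * w_dissipation t\<close>, which turns the factor 5/4 into 1. The f' term then
  contributes the constant \<open>\<gamma>lo / (2 * L)\<close>.\<close>

lemma strain_energy_derivative:
  assumes t: "t \<in> {0<..<T}" and small: "\<delta>\<^sup>2 * \<theta>_energy t \<le> \<gamma>lo\<^sup>2 / (8 * L)"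
  shows "\<exists>d. ((\<lambda>t. w_energy t + u_energy t) has_real_derivative d) (at t) \<and>
    d \<le> - \<gamma>lo * w_dissipation t
      + (2 * a + a\<^sup>2 + 1 + \<gamma>lo / (2 * L)) * (w_energy t + u_energy t + 1)"
proof -
  obtain d e where d: "(w_energy has_real_derivative d) (at t)"
      "d \<le> - (5 / 4) * \<gamma>lo * w_dissipation t + (2 * \<delta>\<^sup>2 * (L * w_dissipation t) / \<gamma>lo + 4 * \<delta>\<^sup>2 / \<gamma>lo) * \<theta>_energy t
        + (2 * a + a\<^sup>2) * w_energy t + a\<^sup>2 * u_energy t"
    and e: "(u_energy has_real_derivative e) (at t)" "e \<le> u_energy t + w_energy t"
    using w_energy_derivative[OF t] u_energy_derivative[OF t] by blast
  note nn = energies_nonneg[of t]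
  have "(2 * \<delta>\<^sup>2 * (L * w_dissipation t) / \<gamma>lo + 4 * \<delta>\<^sup>2 / \<gamma>lo) * \<theta>_energy t
      = (2 * L * w_dissipation t / \<gamma>lo + 4 / \<gamma>lo) * (\<delta>\<^sup>2 * \<theta>_energy t)"
    using \<gamma>lo by (simp add: field_simps)
  also have "\<dots> \<le> (2 * L * w_dissipation t / \<gamma>lo + 4 / \<gamma>lo) * (\<gamma>lo\<^sup>2 / (8 * L))"
    using small nn L_pos \<gamma>lo by (intro mult_left_mono) auto
  also have "\<dots> = \<gamma>lo * w_dissipation t / 4 + \<gamma>lo / (2 * L)"
    using \<gamma>lo L_pos by (simp add: field_simps power2_eq_square)
  finally have 1: "d \<le> - \<gamma>lo * w_dissipation t + \<gamma>lo / (2 * L)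
      + (2 * a + a\<^sup>2) * w_energy t + a\<^sup>2 * u_energy t"
    using d(2) by simp
  define k where "k = \<gamma>lo / (2 * L)"
  have k: "0 \<le> k" using \<gamma>lo L_pos by (simp add: k_def)
  have "d + e \<le> - \<gamma>lo * w_dissipation t + k + (2 * a + a\<^sup>2) * w_energy t + a\<^sup>2 * u_energy t
      + (u_energy t + w_energy t)"
    using 1 e(2) by (simp add: k_def)
  \<comment> \<open>The added terms are nonnegative and complete the expression to a multiple of
    \<open>w_energy t + u_energy t + 1\<close>.\<close>
  also have "\<dots> \<le> \<dots> + (k * w_energy t + k * u_energy t + 2 * a * u_energy t + (2 * a + a\<^sup>2 + 1))"
    using k a nn by simp
  also have "\<dots> = - \<gamma>lo * w_dissipation t + (2 * a + a\<^sup>2 + 1 + k) * (w_energy t + u_energy t + 1)"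
    by (simp add: algebra_simps)
  finally have "d + e \<le> - \<gamma>lo * w_dissipation t + (2 * a + a\<^sup>2 + 1 + k) * (w_energy t + u_energy t + 1)" .
  then show ?thesis using DERIV_add[OF d(1) e(1)] by (auto simp: k_def)
qed

text \<open>The weight \<open>\<kappa>\<close> is large enough for the dissipation of \<open>w\<close> to absorb all terms
  \<open>\<parallel>w\<^sub>x\<parallel>\<^sub>\<infinity>\<^sup>2\<close> from the other two energies.\<close>

lemma total_energy_derivative:
  fixes c1 c2 K \<kappa> :: real
  assumes t: "t \<in> {0<..<T}" and small: "\<delta>\<^sup>2 * \<theta>_energy t \<le> \<gamma>lo\<^sup>2 / (8 * L)"
    and c1: "c1 = 2 * a + a\<^sup>2 + 1 + \<gamma>lo / (2 * L)"
    and c2: "c2 = (8 * \<gamma>hi\<^sup>2 * (L + a ^ 4) + 4 * C\<^sup>2 * (1 + L) * (1 + a\<^sup>2)) / D"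
    and K: "w_energy t + u_energy t \<le> K"
    and \<kappa>: "\<kappa> = (L + c2) * K / \<gamma>lo"
  defines "H \<equiv> \<lambda>t. \<kappa> * (w_energy t + u_energy t) + u_quartic t + \<theta>_energy t"
  shows "\<exists>d. (H has_real_derivative d) (at t) \<and>
    d \<le> (c1 + \<kappa> * c1 + 3 + c2 + c2 * K) * (H t + 1)"
proof -
  define A U Q Z W where defs: "A = w_energy t" "U = u_energy t" "Q = u_quartic t"
    "Z = \<theta>_energy t" "W = w_dissipation t"
  have nn: "0 \<le> A" "0 \<le> U" "0 \<le> Q" "0 \<le> Z" "0 \<le> W" using energies_nonneg by (auto simp: defs)
  have AU: "A + U \<le> K" using K by (simp add: defs)
  obtain d e h where d: "((\<lambda>t. w_energy t + u_energy t) has_real_derivative d) (at t)"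
      "d \<le> - \<gamma>lo * W + c1 * (A + U + 1)"
    and e: "(u_quartic has_real_derivative e) (at t)" "e \<le> 3 * Q + L * W * A"
    and h: "(\<theta>_energy has_real_derivative h) (at t)"
      "h \<le> (8 * \<gamma>hi\<^sup>2 * (L * W) / D) * A + (8 * \<gamma>hi\<^sup>2 * a ^ 4 / D) * Q
        + (4 * C\<^sup>2 * (1 + L * Z) / D) * A + (4 * C\<^sup>2 * (1 + L * Z) / D * a\<^sup>2) * U"
    using strain_energy_derivative[OF t small] u_quartic_derivative[OF t] \<theta>_energy_derivative[OF t]
    unfolding defs c1 by blast
  define p q s where pqs: "p = 8 * \<gamma>hi\<^sup>2 * L / D" "q = 8 * \<gamma>hi\<^sup>2 * a ^ 4 / D"
    "s = 4 * C\<^sup>2 * (1 + L) * (1 + a\<^sup>2) / D"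
  have c2': "c2 = p + q + s" by (simp add: c2 pqs field_simps flip: add_divide_distrib)
  have pqs_nn: "0 \<le> p" "0 \<le> q" "0 \<le> s" using D L_pos by (auto simp: pqs)
  have c1_nn: "0 \<le> c1" using a \<gamma>lo L_pos by (simp add: c1)
  have K_nn: "0 \<le> K" using nn AU by simp
  have \<kappa>_nn: "0 \<le> \<kappa>" using K_nn pqs_nn L_pos \<gamma>lo by (simp add: \<kappa> c2')
  \<comment> \<open>The product of dissipation and energy is superlinear. The bound \<open>K\<close>
    makes it linear in the dissipation, where the weight \<kappa> can absorb it.\<close>
  have A_K: "W * A \<le> W * K" using nn AU by (intro mult_left_mono) auto
  have h1: "(8 * \<gamma>hi\<^sup>2 * (L * W) / D) * A \<le> p * (W * K)"
    using mult_left_mono[OF A_K pqs_nn(1)] by (simp add: pqs mult_ac)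
  have "(1 + L * Z) * (A + a\<^sup>2 * U) \<le> ((1 + L) * (1 + Z)) * ((1 + a\<^sup>2) * K)"
  proof (rule mult_mono)
    show "1 + L * Z \<le> (1 + L) * (1 + Z)" using L_pos nn by (simp add: algebra_simps)
    have "(1 + a\<^sup>2) * (A + U) \<le> (1 + a\<^sup>2) * K" using AU by (intro mult_left_mono) auto
    moreover have "0 \<le> a\<^sup>2 * A" "0 \<le> U" using nn by auto
    ultimately show "A + a\<^sup>2 * U \<le> (1 + a\<^sup>2) * K" by (simp add: algebra_simps)
  qed (use L_pos nn in auto)
  then have "(4 * C\<^sup>2 / D) * ((1 + L * Z) * (A + a\<^sup>2 * U)) \<le> (4 * C\<^sup>2 / D) * (((1 + L) * (1 + Z)) * ((1 + a\<^sup>2) * K))"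
    using D by (intro mult_left_mono) auto
  then have h2: "(4 * C\<^sup>2 * (1 + L * Z) / D) * A + (4 * C\<^sup>2 * (1 + L * Z) / D * a\<^sup>2) * U \<le> s * ((1 + Z) * K)"
    by (simp add: pqs algebra_simps add_divide_distrib)
  have h3: "h \<le> p * (W * K) + q * Q + s * ((1 + Z) * K)"
    using h(2) h1 h2 by (simp add: pqs)
  have e2: "e \<le> 3 * Q + L * (W * K)"
    using e(2) mult_left_mono[OF A_K less_imp_le[OF L_pos]] by (simp add: mult_ac)
  have "\<kappa> * d \<le> \<kappa> * (- \<gamma>lo * W + c1 * (A + U + 1))" using d(2) \<kappa>_nn by (intro mult_left_mono)
  \<comment> \<open>The definition of \<kappa> gives \<kappa> \<gamma>lo = (L + c2) K; the parts L
    and c2 pay for the quartic and the thermal energy respectively.\<close>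
  also have "\<dots> = - (L + c2) * (W * K) + \<kappa> * c1 * (A + U + 1)"
    using \<gamma>lo by (simp add: \<kappa> field_simps)
  finally have d2: "\<kappa> * d \<le> \<dots>" .
  \<comment> \<open>Remainders from rounding \<open>p\<close>, \<open>q\<close> and \<open>s\<close>
    up to their sum \<open>c2\<close>, so that one constant serves all terms.\<close>
  have WK: "0 \<le> q * (W * K)" "0 \<le> s * (W * K)" using nn K_nn pqs_nn by auto
  have ZK: "0 \<le> (p + q) * ((1 + Z) * K)" "0 \<le> (p + s) * Q" using nn K_nn pqs_nn by auto
  have "\<kappa> * d + e + h \<le> \<kappa> * c1 * (A + U + 1) + (3 + c2) * Q + c2 * ((1 + Z) * K)"
    using d2 e2 h3 WK ZK unfolding c2' by (simp add: algebra_simps)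
  also have "\<dots> \<le> (c1 + \<kappa> * c1 + 3 + c2 + c2 * K) * (\<kappa> * (A + U) + Q + Z + 1)"
  proof -
    have c2_nn: "0 \<le> c2" using pqs_nn by (simp add: c2')
    \<comment> \<open>These are exactly the products on the right-hand side that have no counterpart
      on the left.\<close>
    have "0 \<le> (\<kappa> * c1 + 3 + c2 + c2 * K) * (\<kappa> * (A + U))" "0 \<le> (c1 + \<kappa> * c1 + c2 * K) * Q"
      "0 \<le> (c1 + \<kappa> * c1 + 3 + c2) * Z" "0 \<le> c1 + 3 + c2"
      using c2_nn c1_nn \<kappa>_nn K_nn nn by (auto intro!: mult_nonneg_nonneg add_nonneg_nonneg)
    then show ?thesis by (simp add: algebra_simps)
  qed
  finally have "\<kappa> * d + e + h \<le> (c1 + \<kappa> * c1 + 3 + c2 + c2 * K) * (H t + 1)"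
    by (simp add: H_def defs)
  moreover have "(H has_real_derivative \<kappa> * d + e + h) (at t)"
    unfolding H_def by (intro DERIV_add DERIV_cmult d e h)
  ultimately show ?thesis by blast
qed

text \<open>While \<open>\<theta>_energy\<close> is below \<open>K2\<close>, the hypothesis on
  \<delta> makes the coefficient terms absorbable. Gronwall then bounds the strain energies by
  \<open>K1\<close>, and a second Gronwall argument with weight \<kappa> returns the bound
  \<open>K2\<close>. No constant in this chain contains \<delta>, so there is no
  circularity.\<close>

lemma a_priori_bounds:
  fixes c1 c2 K1 \<kappa> c3 K2 M S :: real
  assumes S: "T \<le> S" and M: "0 \<le> M"
    and c1: "c1 = 2 * a + a\<^sup>2 + 1 + \<gamma>lo / (2 * L)"
    and K1: "K1 = ((3 + 2 * a\<^sup>2) * M + 1) * exp (c1 * S)"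
    and c2: "c2 = (8 * \<gamma>hi\<^sup>2 * (L + a ^ 4) + 4 * C\<^sup>2 * (1 + L) * (1 + a\<^sup>2)) / D"
    and \<kappa>: "\<kappa> = (L + c2) * K1 / \<gamma>lo"
    and c3: "c3 = c1 + \<kappa> * c1 + 3 + c2 + c2 * K1"
    and K2: "K2 = (\<kappa> * ((3 + 2 * a\<^sup>2) * M) + M + 1) * exp (c3 * S)"
    and \<delta>: "\<delta>\<^sup>2 * K2 \<le> \<gamma>lo\<^sup>2 / (8 * L)"
    and initial: "w_energy 0 + u_energy 0 \<le> (3 + 2 * a\<^sup>2) * M" "u_quartic 0 + \<theta>_energy 0 \<le> M"
    and t: "t \<in> {0..<T}"
  shows "w_energy t + u_energy t \<le> K1 \<and> \<theta>_energy t \<le> K2"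
proof -
  have c1_nn: "0 \<le> c1" using a \<gamma>lo L_pos by (simp add: c1)
  have c2_nn: "0 \<le> c2" using L_pos D by (simp add: c2)
  have K1_nn: "0 \<le> K1" using M by (simp add: K1)
  have \<kappa>_nn: "0 \<le> \<kappa>" using K1_nn c2_nn L_pos \<gamma>lo by (simp add: \<kappa>)
  have c3_nn: "0 \<le> c3" using c1_nn c2_nn K1_nn \<kappa>_nn by (simp add: c3)
  have strain: "w_energy \<tau> + u_energy \<tau> + 1 \<le> K1"
    if \<tau>: "\<tau> \<in> {0..<T}" and small: "\<And>s. s \<in> {0<..<\<tau>} \<Longrightarrow> \<delta>\<^sup>2 * \<theta>_energy s \<le> \<gamma>lo\<^sup>2 / (8 * L)" for \<tau>
  proof -
    have "w_energy \<tau> + u_energy \<tau> + 1 \<le> (w_energy 0 + u_energy 0 + 1) * exp (c1 * \<tau>)"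
    proof (rule gronwall_affine)
      show "continuous_on {0..\<tau>} (\<lambda>t. w_energy t + u_energy t)"
        using \<tau> by (auto intro!: continuous_intros continuous_on_subset[OF energies_continuous(1)]
            continuous_on_subset[OF energies_continuous(2)])
      fix s assume s: "s \<in> {0<..<\<tau>}"
      then have "s \<in> {0<..<T}" "0 \<le> \<gamma>lo * w_dissipation s"
        using \<tau> \<gamma>lo energies_nonneg by auto
      then show "\<exists>d. ((\<lambda>t. w_energy t + u_energy t) has_real_derivative d) (at s) \<and>
          d \<le> c1 * (w_energy s + u_energy s + 1)"
        using strain_energy_derivative[OF _ small[OF s]] unfolding c1 by fastforce
    qed (use \<tau> in auto)
    also have "\<dots> \<le> K1"
      unfolding K1 using \<tau> S initial M c1_nn energies_nonneg[of 0]
      by (intro mult_mono) (auto intro!: mult_left_mono)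
    finally show ?thesis .
  qed
  have bound: "\<theta>_energy \<tau> < K2" if "\<tau> \<in> {0..<T}" for \<tau>
  proof (rule continuity_bootstrap[OF energies_continuous(4) _ that])
    fix \<tau> assume \<tau>: "\<tau> \<in> {0..<T}" and less: "\<And>s. s \<in> {0..<\<tau>} \<Longrightarrow> \<theta>_energy s < K2"
    have small: "\<delta>\<^sup>2 * \<theta>_energy s \<le> \<gamma>lo\<^sup>2 / (8 * L)" if "s \<in> {0<..<\<tau>}" for s
      using mult_left_mono[OF less_imp_le[OF less[of s]], of "\<delta>\<^sup>2"] \<delta> that by simp
    define H where "H = (\<lambda>t. \<kappa> * (w_energy t + u_energy t) + u_quartic t + \<theta>_energy t)"
    have "\<theta>_energy \<tau> + 1 \<le> H \<tau> + 1"
      using \<kappa>_nn energies_nonneg by (simp add: H_def)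
    also have "\<dots> \<le> (H 0 + 1) * exp (c3 * \<tau>)"
    proof (rule gronwall_affine)
      show "continuous_on {0..\<tau>} H"
        unfolding H_def using \<tau>
        by (auto intro!: continuous_intros continuous_on_subset[OF energies_continuous(1)]
            continuous_on_subset[OF energies_continuous(2)] continuous_on_subset[OF energies_continuous(3)]
            continuous_on_subset[OF energies_continuous(4)])
      fix s assume s: "s \<in> {0<..<\<tau>}"
      have "w_energy s + u_energy s + 1 \<le> K1"
        using s \<tau> by (intro strain small) auto
      then show "\<exists>d. (H has_real_derivative d) (at s) \<and> d \<le> c3 * (H s + 1)"
        using s \<tau> unfolding H_def c3
        by (intro total_energy_derivative[OF _ small[OF s] c1 c2 _ \<kappa>]) auto
    qed (use \<tau> in auto)
    also have "\<dots> \<le> K2"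
      unfolding K2 H_def
    proof (intro mult_mono)
      show "\<kappa> * (w_energy 0 + u_energy 0) + u_quartic 0 + \<theta>_energy 0 + 1
          \<le> \<kappa> * ((3 + 2 * a\<^sup>2) * M) + M + 1"
        using mult_left_mono[OF initial(1) \<kappa>_nn] initial(2) by simp
      show "exp (c3 * \<tau>) \<le> exp (c3 * S)" using \<tau> S c3_nn by (auto intro!: mult_left_mono)
    qed (use \<kappa>_nn M in auto)
    \<comment> \<open>The summand 1 carried along by \<open>gronwall_affine\<close> makes the
      inequality strict, as the bootstrap requires.\<close>
    finally show "\<theta>_energy \<tau> < K2" by simp
  qed
  have "\<delta>\<^sup>2 * \<theta>_energy s \<le> \<gamma>lo\<^sup>2 / (8 * L)" if "s \<in> {0<..<t}" for s
    using mult_left_mono[OF less_imp_le[OF bound[of s]], of "\<delta>\<^sup>2"] \<delta> that t by simp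
  then show ?thesis using strain[OF t] bound[OF t] by simp
qed

section \<open>Bounds for the norms in the extensibility criterion\<close>

lemma velocity_mean_constant: "\<exists>m. \<forall>t\<in>{0<..<T}. integral {l..r} (\<lambda>x. v x t) = m"
proof -
  have "((\<lambda>t. integral {l..r} (\<lambda>x. v x t)) has_real_derivative 0) (at t within {0<..<T})"
    if t: "t \<in> {0<..<T}" for t
  proof -
    \<comment> \<open>The flux: its space derivative is \<open>vt\<close>, and at both endpoints it
      equals \<open>f 0\<close> because \<open>wx\<close> and \<theta> vanish there. Hence the
      integral of \<open>vt\<close> is zero.\<close>
    let ?h = "\<lambda>x. g (\<theta> x t) * wx x t + f (\<theta> x t)"
    have comp: "((\<lambda>x. k (\<theta> x t)) has_real_derivative k' (\<theta> x t) * \<theta>x x t) (at x within {l..r})"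
      if "\<And>s. s \<ge> 0 \<Longrightarrow> (k has_real_derivative k' s) (at s within {0..})" "x \<in> {l..r}" for k k' x
      using \<theta>_nonneg t that
      by (intro chain_rule_into[where S = "{0..}"] C21_derivs_space(1)[OF \<theta> t]) auto
    have h: "(?h has_real_derivative vt x t) (at x within {l..r})" if x: "x \<in> {l<..<r}" for x
    proof -
      have x': "x \<in> {l..r}" using x by simp
      have "(?h has_real_derivative g' (\<theta> x t) * \<theta>x x t * wx x t + wxx x t * g (\<theta> x t)
          + f' (\<theta> x t) * \<theta>x x t) (at x within {l..r})"
        by (intro DERIV_add DERIV_mult comp[OF g x'] comp[OF f x'] C21_derivs_space(2)[OF w t x'])
      moreover have "g' (\<theta> x t) * \<theta>x x t * wx x t + wxx x t * g (\<theta> x t)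
          + f' (\<theta> x t) * \<theta>x x t = vt x t"
        using momentum[OF x t] by (simp add: wx_def wxx_def algebra_simps)
      ultimately show ?thesis by simp
    qed
    have "continuous_on {l..r} (\<lambda>x. g (\<theta> x t))"
      by (rule continuous_on_if_has_real_derivative, rule comp[OF g])
    moreover have "continuous_on {l..r} (\<lambda>x. f (\<theta> x t))"
      by (rule continuous_on_if_has_real_derivative, rule comp[OF f])
    ultimately have "continuous_on {l..r} ?h"
      by (intro continuous_intros t)
    \<comment> \<open>The momentum equation holds only inside, so the fundamental theorem is applied
      with interior derivatives and continuity up to the endpoints.\<close>
    then have "((\<lambda>x. vt x t) has_integral ?h r - ?h l) {l..r}"
      using lr h by (intro fundamental_theorem_of_calculus_interior)
        (auto simp: at_within_Icc_at simp flip: has_real_derivative_iff_has_vector_derivative)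
    then have "integral {l..r} (\<lambda>x. vt x t) = 0"
      using wx_boundary dirichlet t by (simp add: integral_unique)
    moreover have "((\<lambda>t. integral {l..r} (\<lambda>x. v x t ^ 1)) has_real_derivative
        integral {l..r} (\<lambda>x. real 1 * v x t ^ (1 - 1) * vt x t)) (at t)"
      using v t unfolding C21_derivs_def by (intro integral_power_derivative) auto
    ultimately show ?thesis by (simp add: has_field_derivative_at_within)
  qed
  then have "\<exists>c. \<forall>t\<in>{0<..<T}. integral {l..r} (\<lambda>x. v x t) = c"
    by (intro has_field_derivative_zero_constant) auto
  then show ?thesis .
qed

text \<open>The energies bound the slope of \<open>v\<close> and hence its oscillation; the
  conserved mean then fixes its size. The bound may depend on the solution through that mean, since
  the criterion asks only for finiteness.\<close>

lemma extensibility_norms_bounded: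
  assumes K1: "\<And>t. t \<in> {0<..<T} \<Longrightarrow> w_energy t + u_energy t \<le> K1"
    and K2: "\<And>t. t \<in> {0<..<T} \<Longrightarrow> \<theta>_energy t \<le> K2"
  shows "\<exists>B. \<forall>t\<in>{0<..<T}. integral {l..r} (\<lambda>x. (v x t)\<^sup>2) + integral {l..r} (\<lambda>x. (vx x t)\<^sup>2) \<le> B \<and>
    (\<forall>x\<in>{l..r}. \<bar>\<theta> x t\<bar> \<le> B)"
proof -
  obtain m where m: "\<And>t. t \<in> {0<..<T} \<Longrightarrow> integral {l..r} (\<lambda>x. v x t) = m"
    using velocity_mean_constant by blast
  define E where "E = (2 + 2 * a\<^sup>2) * K1"
  define N where "N = (\<bar>m\<bar> + L * sqrt (L * E)) / L"
  have "integral {l..r} (\<lambda>x. (v x t)\<^sup>2) + integral {l..r} (\<lambda>x. (vx x t)\<^sup>2) \<le> L * N\<^sup>2 + E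
    \<and> (\<forall>x\<in>{l..r}. \<bar>\<theta> x t\<bar> \<le> sqrt (L * K2))" if t: "t \<in> {0<..<T}" for t
  proof -
    have vx: "integral {l..r} (\<lambda>x. (vx x t)\<^sup>2) \<le> E"
    proof -
      have "integral {l..r} (\<lambda>x. (vx x t)\<^sup>2) \<le> 2 * w_energy t + 2 * a\<^sup>2 * u_energy t"
      proof (rule has_integral_le_interior)
        show "((\<lambda>x. (vx x t)\<^sup>2) has_integral integral {l..r} (\<lambda>x. (vx x t)\<^sup>2)) {l..r}"
          by (intro integrable_integral integrable_continuous_real continuous_intros t)
        show "((\<lambda>x. 2 * (wx x t)\<^sup>2 + 2 * a\<^sup>2 * (ux x t)\<^sup>2) has_integral
            2 * w_energy t + 2 * a\<^sup>2 * u_energy t) {l..r}"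
          by (intro has_integral_add has_integral_mult_right has_integrals t)
        show "(vx x t)\<^sup>2 \<le> 2 * (wx x t)\<^sup>2 + 2 * a\<^sup>2 * (ux x t)\<^sup>2" for x
          using sum_square_le[of "wx x t" "- (a * ux x t)"] by (simp add: wx_def power_mult_distrib)
      qed
      also have "\<dots> \<le> (2 + 2 * a\<^sup>2) * (w_energy t + u_energy t)"
        using energies_nonneg[of t] by (simp add: algebra_simps)
      also have "\<dots> \<le> E" unfolding E_def using K1[OF t] by (intro mult_left_mono) auto
      finally show ?thesis .
    qed
    have osc: "\<bar>v x t - v y t\<bar> \<le> sqrt (L * E)" if "x \<in> {l..r}" "y \<in> {l..r}" for x y
    proof -
      have *: "(v x t - v y t)\<^sup>2 \<le> L * E" if "l \<le> y" "y \<le> x" "x \<le> r" for x y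
      proof -
        have "(v x t - v y t)\<^sup>2 \<le> (r - l) * integral {l..r} (\<lambda>x. (vx x t)\<^sup>2)"
          using that
          by (intro square_le_integral_deriv_square C21_derivs_space[OF v t] C21_derivs_slices[OF v t]) auto
        also have "\<dots> \<le> L * E" using vx L_pos by (simp add: L_def mult_left_mono)
        finally show ?thesis .
      qed
      have "(v x t - v y t)\<^sup>2 \<le> L * E"
        using *[of y x] *[of x y] that by (cases "y \<le> x") (auto simp: power2_commute)
      then show ?thesis by (simp add: real_le_rsqrt)
    qed
    have vN: "(v x t)\<^sup>2 \<le> N\<^sup>2" if x: "x \<in> {l..r}" for x
    proof -
      have c: "((\<lambda>y. k) has_integral L * k) {l..r}" for k :: real
        using has_integral_const_real[of k l r] lr by (simp add: L_def)
      have mi: "((\<lambda>y. v y t) has_integral m) {l..r}"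
        unfolding m[OF t, symmetric]
        by (intro integrable_integral integrable_continuous_real continuous_intros t)
      \<comment> \<open>The oscillation estimate is integrated over the second point, which compares
        \<open>L * v x t\<close> with the mean and leads to \<open>N\<close>.\<close>
      have "L * (v x t - sqrt (L * E)) \<le> m"
        using osc[OF x, THEN abs_le_D1] by (intro has_integral_le_interior[OF c mi]) (simp add: algebra_simps)
      moreover have "m \<le> L * (v x t + sqrt (L * E))"
        using osc[OF x, THEN abs_le_D2] by (intro has_integral_le_interior[OF mi c]) (simp add: algebra_simps)
      ultimately have "\<bar>L * v x t\<bar> \<le> \<bar>m\<bar> + L * sqrt (L * E)"
        by (simp add: algebra_simps abs_le_iff) linarith
      then have "\<bar>v x t\<bar> \<le> N"
        using L_pos by (simp add: N_def abs_mult field_simps)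
      then show ?thesis using power_mono[of "\<bar>v x t\<bar>" N 2] by simp
    qed
    have "integral {l..r} (\<lambda>x. (v x t)\<^sup>2) \<le> L * N\<^sup>2"
    proof (rule has_integral_le_interior)
      show "((\<lambda>x. (v x t)\<^sup>2) has_integral integral {l..r} (\<lambda>x. (v x t)\<^sup>2)) {l..r}"
        by (intro integrable_integral integrable_continuous_real continuous_intros t)
      show "((\<lambda>x. N\<^sup>2) has_integral L * N\<^sup>2) {l..r}"
        using has_integral_const_real[of "N\<^sup>2" l r] lr by (simp add: L_def)
    qed (use vN in auto)
    moreover have "\<bar>\<theta> x t\<bar> \<le> sqrt (L * K2)" if "x \<in> {l..r}" for x
      using order_trans[OF \<theta>_square_le[OF that t] mult_left_mono[OF K2[OF t]]] L_pos
      by (auto intro!: real_le_rsqrt)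
    ultimately show ?thesis using vx by auto
  qed
  then show ?thesis
    by (intro exI[of _ "max (L * N\<^sup>2 + E) (sqrt (L * K2))"]) (fastforce simp: le_max_iff_disj)
qed

end

section \<open>Maximal classical solutions\<close>

lemma has_real_derivative_deriv_on:
  "g differentiable_on S \<Longrightarrow> x \<in> S \<Longrightarrow> (g has_real_derivative deriv_on S g x) (at x within S)"
  by (simp add: deriv_on_def differentiable_on_def has_real_derivative_iff_has_vector_derivative
      flip: vector_derivative_works)

lemma deriv_on_Icc_eq:
  assumes "l < r" "x \<in> {l..r}" "(g has_real_derivative d) (at x within {l..r})"
  shows "deriv_on {l..r} g x = d"
  using assms vector_derivative_within_cbox[of l r x g d]
  by (simp add: deriv_on_def has_real_derivative_iff_has_vector_derivative)

lemma deriv_on_interior: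
  assumes "x \<in> interior S"
  shows "deriv_on S g x = vector_derivative g (at x)"
  using at_within_interior[OF assms] by (simp add: deriv_on_def)

text \<open>The initial conditions are imposed on the open interval only; this transfers them to
  derivatives at interior points.\<close>

lemma deriv_on_cong_Ioo:
  assumes "x \<in> {l<..<r}" "\<And>y. y \<in> {l<..<r} \<Longrightarrow> p y = q y"
  shows "deriv_on {l..r} p x = deriv_on {l..r} q x"
proof -
  have "\<forall>\<^sub>F y in nhds x. y \<in> {l<..<r}" using assms(1) by (intro eventually_nhds_in_open) auto
  then have "\<forall>\<^sub>F y in nhds x. y \<in> {l..r} \<longrightarrow> p y = q y"
    by eventually_elim (use assms(2) in auto)
  then show ?thesis
    using assms unfolding deriv_on_def
    by (intro vector_derivative_cong_eq) auto
qed

lemma time_sets: "time_Ico (ereal T) = {0..<T}" "time_Ioo (ereal T) = {0<..<T}"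
  by (auto simp: time_Ico_def time_Ioo_def)

lemma C21_on_derivs:
  assumes "C21_on {l..r} {0<..<T} p"
  shows "C21_derivs l r T p (dx {l..r} p) (dx {l..r} (dx {l..r} p)) (dt {0<..<T} p)"
proof -
  have "(p x has_real_derivative dt {0<..<T} p x t) (at t)"
    if "x \<in> {l..r}" "t \<in> {0<..<T}" for x t
  proof -
    have "(\<lambda>t. p x t) differentiable_on {0<..<T}" using assms that by (simp add: C21_on_def)
    from has_real_derivative_deriv_on[OF this that(2)] show ?thesis
      using that by (simp add: dt_def at_within_open[of t "{0<..<T}"])
  qed
  moreover have "((\<lambda>y. p y t) has_real_derivative dx {l..r} p x t) (at x within {l..r})"
    "((\<lambda>y. dx {l..r} p y t) has_real_derivative dx {l..r} (dx {l..r} p) x t) (at x within {l..r})"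
    if "x \<in> {l..r}" "t \<in> {0<..<T}" for x t
  proof -
    have "(\<lambda>y. p y t) differentiable_on {l..r}" "(\<lambda>y. dx {l..r} p y t) differentiable_on {l..r}"
      using assms that by (simp_all add: C21_on_def)
    from this[THEN has_real_derivative_deriv_on[OF _ that(1)]]
    show "((\<lambda>y. p y t) has_real_derivative dx {l..r} p x t) (at x within {l..r})"
      "((\<lambda>y. dx {l..r} p y t) has_real_derivative dx {l..r} (dx {l..r} p) x t) (at x within {l..r})"
      by (simp_all add: dx_def[abs_def])
  qed
  ultimately show ?thesis using assms by (simp add: C21_derivs_def C21_on_def)
qed

lemma parabolic_holder_continuous_dx:
  assumes "parabolic_holder \<eta> K J p" "0 < \<eta>"
  shows "continuous_on (K \<times> J) (\<lambda>(x, t). dx K p x t)"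
proof -
  obtain C where C: "\<And>x y t s. x \<in> K \<Longrightarrow> y \<in> K \<Longrightarrow> t \<in> J \<Longrightarrow> s \<in> J \<Longrightarrow>
      \<bar>dx K p x t - dx K p y s\<bar> \<le> C * (\<bar>x - y\<bar> powr \<eta> + \<bar>t - s\<bar> powr (\<eta> / 2))"
    using assms(1) unfolding parabolic_holder_def by blast
  have "((\<lambda>(x, t). dx K p x t) \<longlongrightarrow> dx K p y s) (at (y, s) within K \<times> J)"
    if ys: "y \<in> K" "s \<in> J" for y s
  proof (rule Lim_null[THEN iffD2], rule Lim_null_comparison)
    let ?F = "at (y, s) within K \<times> J"
    have fs: "((\<lambda>z. fst z) \<longlongrightarrow> y) ?F" "((\<lambda>z. snd z) \<longlongrightarrow> s) ?F"
      by (auto intro!: tendsto_eq_intros)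
    have "((\<lambda>z. C * (\<bar>fst z - y\<bar> powr \<eta> + \<bar>snd z - s\<bar> powr (\<eta> / 2))) \<longlongrightarrow>
        C * (\<bar>y - y\<bar> powr \<eta> + \<bar>s - s\<bar> powr (\<eta> / 2))) ?F"
      using assms(2) by (intro tendsto_intros tendsto_powr' fs) auto
    then show "((\<lambda>z. C * (\<bar>fst z - y\<bar> powr \<eta> + \<bar>snd z - s\<bar> powr (\<eta> / 2))) \<longlongrightarrow> 0) ?F" by simp
    show "\<forall>\<^sub>F z in ?F. norm ((case z of (x, t) \<Rightarrow> dx K p x t) - dx K p y s)
        \<le> C * (\<bar>fst z - y\<bar> powr \<eta> + \<bar>snd z - s\<bar> powr (\<eta> / 2))"
      using C ys by (auto simp: eventually_at_filter intro!: always_eventually)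
  qed
  then show ?thesis by (auto simp: continuous_on_def)
qed

lemma solution_space_continuous_dx:
  assumes "solution_space l r (ereal T) p"
  shows "continuous_on ({l..r} \<times> {0..<T}) (\<lambda>(x, t). dx {l..r} p x t)"
proof -
  obtain \<eta> where \<eta>: "0 < \<eta>" "\<And>T'. 0 < T' \<Longrightarrow> T' < T \<Longrightarrow> parabolic_holder \<eta> {l..r} {0..T'} p"
    using assms unfolding solution_space_def by auto
  show ?thesis
    unfolding continuous_on_def
  proof
    fix z assume z: "z \<in> {l..r} \<times> {0..<T}"
    obtain x t where z_eq: "z = (x, t)" by (cases z)
    from z have xt: "x \<in> {l..r}" "t \<in> {0..<T}" by (auto simp: z_eq)
    \<comment> \<open>Holder regularity is local in time. The interval [0,T'] reaches beyond t and
      is therefore a neighbourhood of t within [0,T), also for t = 0.\<close>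
    then obtain T' where T': "t < T'" "T' < T" using dense by auto
    with xt have "continuous_on ({l..r} \<times> {0..T'}) (\<lambda>(x, t). dx {l..r} p x t)"
      by (intro parabolic_holder_continuous_dx[OF \<eta>(2) \<eta>(1)]) auto
    moreover have "(x, t) \<in> {l..r} \<times> {0..T'}" using xt T' by simp
    ultimately have "((\<lambda>(x, t). dx {l..r} p x t) \<longlongrightarrow> dx {l..r} p x t) (at (x, t) within {l..r} \<times> {0..T'})"
      unfolding continuous_on_def by fastforce
    moreover have "at (x, t) within {l..r} \<times> {0..T'} = at (x, t) within {l..r} \<times> {0..<T}"
    proof (rule at_within_nhd)
      show "open ((UNIV :: real set) \<times> {..<T'})" by (intro open_Times) auto
    qed (use T' in auto)
    ultimately show "((\<lambda>(x, t). dx {l..r} p x t) \<longlongrightarrow> (case z of (x, t) \<Rightarrow> dx {l..r} p x t))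
        (at z within {l..r} \<times> {0..<T})"
      by (simp add: z_eq)
  qed
qed

section \<open>Essential suprema and Lebesgue integrals of continuous functions\<close>

lemma Linfty_norm_continuous_bound:
  assumes c: "continuous_on {0..} h" and n: "Linfty_norm {0..} h \<le> ereal \<delta>" and s: "0 \<le> s"
  shows "\<bar>h s\<bar> \<le> \<delta>"
proof (rule ccontr)
  assume "\<not> \<bar>h s\<bar> \<le> \<delta>"
  then have "0 < \<bar>h s\<bar> - \<delta>" by simp
  then have "\<exists>d>0. \<forall>y\<in>{0..}. dist y s < d \<longrightarrow> dist (h y) (h s) < \<bar>h s\<bar> - \<delta>"
    using c[unfolded continuous_on_iff, rule_format, of s "\<bar>h s\<bar> - \<delta>"] s by simp
  then obtain d where d: "0 < d" "\<And>y. y \<ge> 0 \<Longrightarrow> dist y s < d \<Longrightarrow> dist (h y) (h s) < \<bar>h s\<bar> - \<delta>"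
    by auto
  have "AE x in lebesgue_on {0..}. ereal \<bar>h x\<bar> \<le> ereal \<delta>"
    by (rule eventually_mono[OF esssup_AE order_trans[OF _ n[unfolded Linfty_norm_def]]])
  then have "AE x in lebesgue. x \<in> {0..} \<longrightarrow> \<bar>h x\<bar> \<le> \<delta>"
    by (subst (asm) AE_restrict_space_iff) auto
  \<comment> \<open>A violation at \<open>s\<close> persists by continuity on an interval to the
    right of \<open>s\<close>. That interval lies in the half-line even for \<open>s = 0\<close>,
    and it has positive measure.\<close>
  then have "AE x in lebesgue. x \<notin> {s<..<s + d}"
  proof eventually_elim
    case (elim x)
    show ?case
    proof
      assume "x \<in> {s<..<s + d}"
      then have "dist (h x) (h s) < \<bar>h s\<bar> - \<delta>" "\<bar>h x\<bar> \<le> \<delta>"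
        using d(2)[of x] elim s by (auto simp: dist_real_def)
      then show False by (auto simp: dist_real_def)
    qed
  qed
  then have "{s<..<s + d} \<in> null_sets lebesgue"
    by (subst (asm) AE_iff_null_sets[symmetric]) auto
  then show False using d(1) by (auto simp: null_sets_def)
qed

text \<open>Continuity supplies measurability, which matters because \<open>esssup\<close> takes the
  value \<infinity> on nonmeasurable functions.\<close>

lemma Linfty_norm_le:
  assumes "continuous_on S p" "S \<in> sets lebesgue" "\<And>x. x \<in> S \<Longrightarrow> \<bar>p x\<bar> \<le> B"
  shows "Linfty_norm S p \<le> ereal B"
  unfolding Linfty_norm_def
proof (rule esssup_I)
  have "(\<lambda>x. \<bar>p x\<bar>) \<in> borel_measurable (lebesgue_on S)"
    using assms by (intro continuous_imp_measurable_on_sets_lebesgue continuous_intros)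
  then show "(\<lambda>x. ereal \<bar>p x\<bar>) \<in> borel_measurable (lebesgue_on S)" by simp
  show "AE x in lebesgue_on S. ereal \<bar>p x\<bar> \<le> ereal B"
    using assms(3) by (intro AE_I2) simp
qed

text \<open>\<open>k\<close> stands for a derivative taken as in the problem statement,
  \<open>h\<close> for its counterpart that is continuous up to the endpoints; the two are compared
  only inside.\<close>

lemma lebesgue_integral_Ioo_eq_integral:
  fixes h :: "real \<Rightarrow> real"
  assumes c: "continuous_on {l..r} h" and e: "\<And>x. x \<in> {l<..<r} \<Longrightarrow> k x = h x"
  shows "(\<integral>x. k x \<partial>lebesgue_on {l<..<r}) = integral {l..r} h"
proof -
  have "set_integrable lebesgue {l..r} h"
    using continuous_imp_integrable_real[OF c] by (simp add: set_integrable_def integrable_restrict_space)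
  then have "set_integrable lebesgue {l<..<r} h" by (rule set_integrable_subset) auto
  then have "integrable (lebesgue_on {l<..<r}) h" by (simp add: set_integrable_def integrable_restrict_space)
  then have "(\<integral>x. h x \<partial>lebesgue_on {l<..<r}) = integral {l<..<r} h"
    by (rule lebesgue_integral_eq_integral) simp
  moreover have "(\<integral>x. k x \<partial>lebesgue_on {l<..<r}) = (\<integral>x. h x \<partial>lebesgue_on {l<..<r})"
    using e by (intro Bochner_Integration.integral_cong) auto
  ultimately show ?thesis by (simp add: integral_open_interval_real)
qed

section \<open>A maximal solution satisfies the assumptions of the energy estimates\<close>

lemma maximal_classical_solution_thermoviscoelastic:
  assumes lr: "l < r" and pos: "0 < a" "0 < D" "0 < \<gamma>lo"
    and \<gamma>: "Ck_on 2 {0..} \<gamma>" and f: "Ck_on 2 {0..} f"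
    and bounds: "\<And>s. s \<ge> 0 \<Longrightarrow> \<gamma>lo \<le> \<gamma> s" "\<And>s. s \<ge> 0 \<Longrightarrow> 0 \<le> \<Gamma> s \<and> \<Gamma> s \<le> \<gamma>hi"
      "\<And>s. s \<ge> 0 \<Longrightarrow> \<bar>F s\<bar> \<le> C * (1 + s)"
    and small: "Linfty_norm {0..} (deriv_on {0..} \<gamma>) \<le> ereal \<delta>"
      "Linfty_norm {0..} (deriv_on {0..} f) \<le> ereal \<delta>"
    and sol: "maximal_classical_solution l r a D \<gamma> \<Gamma> f F u0 u0t \<theta>0 (ereal T) u \<theta>"
  defines "K \<equiv> {l..r}"
  defines "v \<equiv> dt {0..<T} u"
  shows "thermoviscoelastic l r T a D \<delta> \<gamma>lo \<gamma>hi C \<gamma> (deriv_on {0..} \<gamma>) f (deriv_on {0..} f) \<Gamma> F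
    u (dx K u) (dx K (dx K u)) v (dx K v) (dx K (dx K v)) (dt {0<..<T} v)
    \<theta> (dx K \<theta>) (dx K (dx K \<theta>)) (dt {0<..<T} \<theta>)"
proof -
  note sol' = sol[unfolded maximal_classical_solution_def classical_solution_def Let_def time_sets,
      folded v_def K_def]
  have T: "0 < T" and du: "\<And>x. x \<in> K \<Longrightarrow> (\<lambda>t. u x t) differentiable_on {0..<T}"
    and spaces: "solution_space l r (ereal T) u" "solution_space l r (ereal T) v"
      "solution_space l r (ereal T) \<theta>"
    and nonneg: "\<And>x t. x \<in> {l<..<r} \<Longrightarrow> t \<in> {0<..<T} \<Longrightarrow> 0 \<le> \<theta> x t"
    and bd: "\<And>x t. x \<in> {l, r} \<Longrightarrow> t \<in> {0<..<T} \<Longrightarrow> dx K u x t = 0 \<and> \<theta> x t = 0"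
    and eqs: "\<And>x t. x \<in> {l<..<r} \<Longrightarrow> t \<in> {0<..<T} \<Longrightarrow>
        dt {0..<T} v x t = dx K (\<lambda>y s. \<gamma> (\<theta> y s) * dx K v y s) x t
          + a * dx K (\<lambda>y s. \<gamma> (\<theta> y s) * dx K u y s) x t + dx K (\<lambda>y s. f (\<theta> y s)) x t"
      "\<And>x t. x \<in> {l<..<r} \<Longrightarrow> t \<in> {0<..<T} \<Longrightarrow>
        dt {0..<T} \<theta> x t = D * dx K (dx K \<theta>) x t + \<Gamma> (\<theta> x t) * (dx K v x t)\<^sup>2
          + F (\<theta> x t) * dx K v x t"
    using sol' by (auto simp: zero_ereal_def)
  have inner: "t \<in> interior {0..<T}" "t \<in> interior {0<..<T}" if "t \<in> {0<..<T}" for t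
    using that interior_maximal[of "{0<..<T}" "{0..<T}"] by (auto simp: interior_open)
  \<comment> \<open>The equations use time derivatives relative to [0,T), the regularity statement
    those relative to (0,T). At positive times both are the two-sided derivative.\<close>
  have dt_eq: "dt {0..<T} p x t = dt {0<..<T} p x t" if "t \<in> {0<..<T}" for p x t
    using inner[OF that] by (simp add: dt_def deriv_on_interior)
  have C: "C21_on {l..r} {0<..<T} u" "C21_on {l..r} {0<..<T} v" "C21_on {l..r} {0<..<T} \<theta>"
    using spaces by (auto simp: solution_space_def time_sets)
  note Cv = C21_on_derivs[OF C(2), folded K_def] and C\<theta> = C21_on_derivs[OF C(3), folded K_def]
  have "(u x has_real_derivative v x t) (at t)" if "x \<in> K" "t \<in> {0<..<T}" for x t
  proof -
    have "(u x has_real_derivative v x t) (at t within {0..<T})"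
      using has_real_derivative_deriv_on[OF du[OF that(1)], of t] that by (simp add: v_def dt_def)
    then show ?thesis using at_within_interior[OF inner(1)[OF that(2)]] by simp
  qed
  \<comment> \<open>\<open>v\<close> replaces the time derivative relative to (0,T), and its joint
    continuity is borrowed from \<open>Cv\<close>.\<close>
  then have Cu: "C21_derivs l r T u (dx K u) (dx K (dx K u)) v"
    using C21_on_derivs[OF C(1), folded K_def] Cv by (simp add: C21_derivs_def K_def)
  have \<theta>_nonneg: "0 \<le> \<theta> x t" if "x \<in> {l..r}" "t \<in> {0<..<T}" for x t
    using nonneg[of x t] bd[of x t] that by (cases "x \<in> {l, r}") auto
  have diff: "\<gamma> differentiable_on {0..}" "f differentiable_on {0..}"
    and cont': "continuous_on {0..} (deriv_on {0..} \<gamma>)" "continuous_on {0..} (deriv_on {0..} f)"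
    using \<gamma> f by (auto simp: numeral_2_eq_2 intro: differentiable_imp_continuous_on)
  have coeff: "(k has_real_derivative deriv_on {0..} k s) (at s within {0..})"
    if "k differentiable_on {0..}" "0 \<le> s" for k s
    using has_real_derivative_deriv_on[of k "{0..}" s] that by simp
  have momentum: "dt {0<..<T} v x t = \<gamma> (\<theta> x t) * (dx K (dx K v) x t + a * dx K (dx K u) x t)
      + deriv_on {0..} \<gamma> (\<theta> x t) * dx K \<theta> x t * (dx K v x t + a * dx K u x t)
      + deriv_on {0..} f (\<theta> x t) * dx K \<theta> x t" if xt: "x \<in> {l<..<r}" "t \<in> {0<..<T}" for x t
  proof -
    have x: "x \<in> {l..r}" using xt by simp
    have comp: "((\<lambda>x. k (\<theta> x t)) has_real_derivative deriv_on {0..} k (\<theta> x t) * dx K \<theta> x t) (at x within {l..r})"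
      if "k differentiable_on {0..}" for k
      using \<theta>_nonneg xt x
      by (intro chain_rule_into[where S = "{0..}"] coeff that C21_derivs_space(1)[OF C\<theta> xt(2) x]) auto
    have prod: "dx K (\<lambda>y s. \<gamma> (\<theta> y s) * p y s) x t
        = deriv_on {0..} \<gamma> (\<theta> x t) * dx K \<theta> x t * p x t + dx K p x t * \<gamma> (\<theta> x t)"
      if "((\<lambda>y. p y t) has_real_derivative dx K p x t) (at x within {l..r})" for p
      unfolding dx_def[of K "\<lambda>y s. \<gamma> (\<theta> y s) * p y s"] unfolding K_def
      by (intro deriv_on_Icc_eq lr x DERIV_mult comp[OF diff(1), unfolded K_def] that[unfolded K_def])
    have "dx K (\<lambda>y s. f (\<theta> y s)) x t = deriv_on {0..} f (\<theta> x t) * dx K \<theta> x t"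
      unfolding dx_def[of K "\<lambda>y s. f (\<theta> y s)"] unfolding K_def
      by (intro deriv_on_Icc_eq lr x comp[OF diff(2), unfolded K_def])
    then show ?thesis
      unfolding dt_eq[OF xt(2), of v x, symmetric] eqs(1)[OF xt]
        prod[OF C21_derivs_space(2)[OF Cu xt(2) x]] prod[OF C21_derivs_space(2)[OF Cv xt(2) x]]
      by (simp add: algebra_simps)
  qed
  show ?thesis
  proof
    show "continuous_on ({l..r} \<times> {0..<T}) (\<lambda>(x, t). dx K u x t)"
      "continuous_on ({l..r} \<times> {0..<T}) (\<lambda>(x, t). dx K v x t)"
      "continuous_on ({l..r} \<times> {0..<T}) (\<lambda>(x, t). dx K \<theta> x t)"
      unfolding K_def by (intro solution_space_continuous_dx spaces)+
    show "(\<gamma> has_real_derivative deriv_on {0..} \<gamma> s) (at s within {0..})"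
      "(f has_real_derivative deriv_on {0..} f s) (at s within {0..})" if "0 \<le> s" for s
      using coeff diff that by auto
    show "\<bar>deriv_on {0..} \<gamma> s\<bar> \<le> \<delta>" "\<bar>deriv_on {0..} f s\<bar> \<le> \<delta>" if "0 \<le> s" for s
      using Linfty_norm_continuous_bound[OF cont'(1) small(1) that]
        Linfty_norm_continuous_bound[OF cont'(2) small(2) that] by auto
    show "dt {0<..<T} \<theta> x t = D * dx K (dx K \<theta>) x t + \<Gamma> (\<theta> x t) * (dx K v x t)\<^sup>2
        + F (\<theta> x t) * dx K v x t" if "x \<in> {l<..<r}" "t \<in> {0<..<T}" for x t
      using eqs(2)[OF that] dt_eq[OF that(2), of \<theta> x] by simp
  qed (use lr T pos Cu Cv C\<theta> bd \<theta>_nonneg bounds momentum in \<open>blast+\<close>)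
qed

section \<open>Choice of the smallness constant and contradiction at the maximal time\<close>

theorem theorem1p2:
  fixes l r a D C\<^sub>F \<alpha> M \<gamma>lo \<gamma>hi Tstar :: real
  assumes "l < r" and "a > 0" and "D > 0" and "C\<^sub>F > 0" and "0 < \<alpha>" and "\<alpha> < 1"
    and "M > 0" and "\<gamma>lo > 0" and "\<gamma>hi > 0" and "Tstar > 0"
  shows "\<exists>\<delta>>0. \<forall>(F :: real \<Rightarrow> real) (\<gamma> :: real \<Rightarrow> real) (\<Gamma> :: real \<Rightarrow> real) (f :: real \<Rightarrow> real)
      (\<mu> :: real) (u0 :: real \<Rightarrow> real) (u0t :: real \<Rightarrow> real) (\<theta>0 :: real \<Rightarrow> real)
      (Tmax :: ereal) (u :: real \<Rightarrow> real \<Rightarrow> real) (\<theta> :: real \<Rightarrow> real \<Rightarrow> real).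
    Ck_on 1 {0..} F \<and> F 0 = 0 \<and> (\<forall>s\<ge>0. \<bar>F s\<bar> \<le> C\<^sub>F * (1 + s) powr \<alpha>) \<and>
    Ck_on 2 {0..} \<gamma> \<and> Ck_on 1 {0..} \<Gamma> \<and> Ck_on 2 {0..} f \<and>
    (\<forall>s\<ge>0. \<gamma> s > 0) \<and> (\<forall>s\<ge>0. \<Gamma> s \<ge> 0) \<and>
    (\<forall>s\<ge>0. \<gamma>lo \<le> \<gamma> s \<and> \<gamma> s \<le> \<gamma>hi) \<and> (\<forall>s\<ge>0. 0 \<le> \<Gamma> s \<and> \<Gamma> s \<le> \<gamma>hi) \<and>
    Linfty_norm {0..} (deriv_on {0..} \<gamma>) \<le> ereal \<delta> \<and>
    Linfty_norm {0..} (deriv_on {0..} f) \<le> ereal \<delta> \<and>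
    0 < \<mu> \<and> \<mu> < 1 \<and>
    Ck_on 2 {l..r} u0 \<and> (\<forall>x\<in>{l, r}. deriv_on {l..r} u0 x = 0) \<and>
    C1_holder_on \<mu> {l..r} u0t \<and> (\<forall>x\<in>{l, r}. deriv_on {l..r} u0t x = 0) \<and>
    C1_holder_on \<mu> {l..r} \<theta>0 \<and> (\<forall>x\<in>{l<..<r}. \<theta>0 x \<ge> 0) \<and> (\<forall>x\<in>{l, r}. \<theta>0 x = 0) \<and>
    (\<integral>x. (deriv_on {l..r} u0t x)\<^sup>2 \<partial>lebesgue_on {l<..<r}) +
      (\<integral>x. (deriv_on {l..r} u0 x)\<^sup>2 \<partial>lebesgue_on {l<..<r}) +
      (\<integral>x. (deriv_on {l..r} u0 x) ^ 4 \<partial>lebesgue_on {l<..<r}) +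
      (\<integral>x. (deriv_on {l..r} \<theta>0 x)\<^sup>2 \<partial>lebesgue_on {l<..<r}) \<le> M \<and>
    maximal_classical_solution l r a D \<gamma> \<Gamma> f F u0 u0t \<theta>0 Tmax u \<theta>
    \<longrightarrow> Tmax \<ge> ereal Tstar"
proof -
  define L where "L = r - l"
  define c1 where "c1 = 2 * a + a\<^sup>2 + 1 + \<gamma>lo / (2 * L)"
  define K1 where "K1 = ((3 + 2 * a\<^sup>2) * M + 1) * exp (c1 * Tstar)"
  define c2 where "c2 = (8 * \<gamma>hi\<^sup>2 * (L + a ^ 4) + 4 * C\<^sub>F\<^sup>2 * (1 + L) * (1 + a\<^sup>2)) / D"
  define \<kappa> where "\<kappa> = (L + c2) * K1 / \<gamma>lo"
  define c3 where "c3 = c1 + \<kappa> * c1 + 3 + c2 + c2 * K1"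
  define K2 where "K2 = (\<kappa> * ((3 + 2 * a\<^sup>2) * M) + M + 1) * exp (c3 * Tstar)"
  \<comment> \<open>Equality case of the smallness condition in \<open>a_priori_bounds\<close>. All
    constants entering it are fixed before the coefficient functions and the data.\<close>
  define \<delta> where "\<delta> = sqrt (\<gamma>lo\<^sup>2 / (8 * L) / K2)"
  note pos = assms
  have L: "0 < L" using pos by (simp add: L_def)
  have "0 \<le> c2" using L pos by (simp add: c2_def)
  moreover have "0 \<le> K1" using pos by (simp add: K1_def)
  ultimately have "0 \<le> \<kappa>" using L pos by (simp add: \<kappa>_def)
  then have "0 \<le> \<kappa> * ((3 + 2 * a\<^sup>2) * M)" using pos by simp
  then have K2: "0 < K2" using pos by (simp add: K2_def)
  have \<delta>: "0 < \<delta>" using L K2 pos by (simp add: \<delta>_def)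
  have \<delta>_K2: "\<delta>\<^sup>2 * K2 \<le> \<gamma>lo\<^sup>2 / (8 * L)"
    using L K2 by (simp add: \<delta>_def)
  have bound: "ereal Tstar \<le> Tmax"
    if F: "\<forall>s\<ge>0. \<bar>F s\<bar> \<le> C\<^sub>F * (1 + s) powr \<alpha>"
      and \<gamma>: "Ck_on 2 {0..} \<gamma>" and f: "Ck_on 2 {0..} f"
      and bounds: "\<forall>s\<ge>0. \<gamma>lo \<le> \<gamma> s \<and> \<gamma> s \<le> \<gamma>hi" "\<forall>s\<ge>0. 0 \<le> \<Gamma> s \<and> \<Gamma> s \<le> \<gamma>hi"
      and small: "Linfty_norm {0..} (deriv_on {0..} \<gamma>) \<le> ereal \<delta>"
        "Linfty_norm {0..} (deriv_on {0..} f) \<le> ereal \<delta>"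
      and M: "(\<integral>x. (deriv_on {l..r} u0t x)\<^sup>2 \<partial>lebesgue_on {l<..<r}) +
          (\<integral>x. (deriv_on {l..r} u0 x)\<^sup>2 \<partial>lebesgue_on {l<..<r}) +
          (\<integral>x. (deriv_on {l..r} u0 x) ^ 4 \<partial>lebesgue_on {l<..<r}) +
          (\<integral>x. (deriv_on {l..r} \<theta>0 x)\<^sup>2 \<partial>lebesgue_on {l<..<r}) \<le> M"
      and sol: "maximal_classical_solution l r a D \<gamma> \<Gamma> f F u0 u0t \<theta>0 Tmax u \<theta>"
    for F \<gamma> \<Gamma> f u0 u0t \<theta>0 :: "real \<Rightarrow> real" and Tmax :: ereal and u \<theta> :: "real \<Rightarrow> real \<Rightarrow> real"
  proof (rule ccontr)
    assume "\<not> ereal Tstar \<le> Tmax"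
    moreover have "0 < Tmax" using sol by (simp add: maximal_classical_solution_def Let_def)
    ultimately obtain T where T: "Tmax = ereal T" "0 < T" "T < Tstar"
      by (cases Tmax) (auto simp: zero_ereal_def)
    define K where "K = {l..r}"
    define v where "v = dt {0..<T} u"
    \<comment> \<open>Since 1 + s \<ge> 1 and \<alpha> < 1, the power is at most 1 + s.\<close>
    have F': "\<bar>F s\<bar> \<le> C\<^sub>F * (1 + s)" if "0 \<le> s" for s
    proof -
      have "(1 + s) powr \<alpha> \<le> (1 + s) powr 1" using that pos by (intro powr_mono) auto
      then have "C\<^sub>F * (1 + s) powr \<alpha> \<le> C\<^sub>F * (1 + s)"
        using that pos by (intro mult_left_mono) auto
      with F that show ?thesis by (blast intro: order_trans)
    qed
    interpret P: thermoviscoelastic l r T a D \<delta> \<gamma>lo \<gamma>hi C\<^sub>F \<gamma> "deriv_on {0..} \<gamma>" f "deriv_on {0..} f" \<Gamma> F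
      u "dx K u" "dx K (dx K u)" v "dx K v" "dx K (dx K v)" "dt {0<..<T} v"
      \<theta> "dx K \<theta>" "dx K (dx K \<theta>)" "dt {0<..<T} \<theta>"
      unfolding K_def v_def
      by (rule maximal_classical_solution_thermoviscoelastic)
        (use pos \<gamma> f bounds F' small sol T in auto)
    have PL: "P.L = L" by (simp add: P.L_def L_def)
    have "u x 0 = u0 x" "v x 0 = u0t x" "\<theta> x 0 = \<theta>0 x" if "x \<in> {l<..<r}" for x
      using sol that
      by (auto simp: maximal_classical_solution_def classical_solution_def Let_def T time_sets v_def)
    then have initial_dx: "deriv_on {l..r} u0 x = dx K u x 0" "deriv_on {l..r} u0t x = dx K v x 0"
      "deriv_on {l..r} \<theta>0 x = dx K \<theta> x 0" if "x \<in> {l<..<r}" for x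
      using that by (auto simp: dx_def K_def intro!: deriv_on_cong_Ioo)
    have slice: "continuous_on {l..r} (\<lambda>x. dx K u x 0)" "continuous_on {l..r} (\<lambda>x. dx K v x 0)"
      "continuous_on {l..r} (\<lambda>x. dx K \<theta> x 0)"
      using P.cont T by (auto intro!: continuous_on_slice[of _ "{0..<T}"])
    define V where "V = integral {l..r} (\<lambda>x. (dx K v x 0)\<^sup>2)"
    have "(\<integral>x. (deriv_on {l..r} u0t x)\<^sup>2 \<partial>lebesgue_on {l<..<r}) = V"
      "(\<integral>x. (deriv_on {l..r} u0 x)\<^sup>2 \<partial>lebesgue_on {l<..<r}) = P.u_energy 0"
      "(\<integral>x. (deriv_on {l..r} u0 x) ^ 4 \<partial>lebesgue_on {l<..<r}) = P.u_quartic 0"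
      "(\<integral>x. (deriv_on {l..r} \<theta>0 x)\<^sup>2 \<partial>lebesgue_on {l<..<r}) = P.\<theta>_energy 0"
      unfolding V_def P.u_energy_def P.u_quartic_def P.\<theta>_energy_def
      by (intro lebesgue_integral_Ioo_eq_integral continuous_intros slice; simp add: initial_dx)+
    with M have M': "V + P.u_energy 0 + P.u_quartic 0 + P.\<theta>_energy 0 \<le> M" by simp
    have V: "0 \<le> V" unfolding V_def by (rule integral_nonneg_real) simp
    note nonneg = V P.energies_nonneg[of 0]
    have "P.w_energy 0 \<le> 2 * V + 2 * a\<^sup>2 * P.u_energy 0"
    proof (rule has_integral_le_interior)
      show "((\<lambda>x. (P.wx x 0)\<^sup>2) has_integral P.w_energy 0) {l..r}"
        unfolding P.w_energy_def P.wx_def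
        by (intro integrable_integral integrable_continuous_real continuous_intros slice)
      show "((\<lambda>x. 2 * (dx K v x 0)\<^sup>2 + 2 * a\<^sup>2 * (dx K u x 0)\<^sup>2) has_integral
          2 * V + 2 * a\<^sup>2 * P.u_energy 0) {l..r}"
        unfolding V_def P.u_energy_def
        by (intro has_integral_add has_integral_mult_right integrable_integral
            integrable_continuous_real continuous_intros slice)
      show "(P.wx x 0)\<^sup>2 \<le> 2 * (dx K v x 0)\<^sup>2 + 2 * a\<^sup>2 * (dx K u x 0)\<^sup>2" for x
        using sum_square_le[of "dx K v x 0" "a * dx K u x 0"] by (simp add: P.wx_def power_mult_distrib)
    qed
    \<comment> \<open>\<open>V\<close> and the initial \<open>u_energy\<close> carry the factors 2
      and 1 + 2 a^2; both are rounded up to the common factor 3 + 2 a^2 that appears in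
      \<open>K1\<close> and \<open>K2\<close>.\<close>
    then have "P.w_energy 0 + P.u_energy 0 \<le> 2 * V + (1 + 2 * a\<^sup>2) * P.u_energy 0"
      by (simp add: algebra_simps)
    also have "\<dots> \<le> (3 + 2 * a\<^sup>2) * V + (3 + 2 * a\<^sup>2) * P.u_energy 0"
      using nonneg by (intro add_mono mult_right_mono) auto
    also have "\<dots> = (3 + 2 * a\<^sup>2) * (V + P.u_energy 0)" by (simp add: algebra_simps)
    also have "\<dots> \<le> (3 + 2 * a\<^sup>2) * M" using M' nonneg by (intro mult_left_mono) auto
    finally have initial: "P.w_energy 0 + P.u_energy 0 \<le> (3 + 2 * a\<^sup>2) * M" .
    have "P.w_energy t + P.u_energy t \<le> K1 \<and> P.\<theta>_energy t \<le> K2" if "t \<in> {0<..<T}" for t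
      by (rule P.a_priori_bounds[where M = M and S = Tstar and ?c1.0 = c1 and ?c2.0 = c2
            and \<kappa> = \<kappa> and ?c3.0 = c3])
        (use that T pos \<delta>_K2 initial M' nonneg in
          \<open>auto simp: PL c1_def K1_def c2_def \<kappa>_def c3_def K2_def\<close>)
    then obtain B where B: "\<And>t. t \<in> {0<..<T} \<Longrightarrow>
        integral {l..r} (\<lambda>x. (v x t)\<^sup>2) + integral {l..r} (\<lambda>x. (dx K v x t)\<^sup>2) \<le> B"
        "\<And>t x. t \<in> {0<..<T} \<Longrightarrow> x \<in> {l..r} \<Longrightarrow> \<bar>\<theta> x t\<bar> \<le> B"
      using P.extensibility_norms_bounded[of K1 K2] by blast
    have norms: "ereal (W12_norm {l<..<r} (\<lambda>x. v x t)) + Linfty_norm {l<..<r} (\<lambda>x. \<theta> x t)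
        \<le> ereal (sqrt B) + ereal B" if t: "t \<in> {0<..<T}" for t
    proof (rule add_mono)
      \<comment> \<open>The norm in the criterion differentiates relative to the open interval,
        \<open>dx K\<close> relative to the closed one; they agree at interior points.\<close>
      have "deriv_on {l<..<r} (\<lambda>x. v x t) x = dx K v x t" if "x \<in> {l<..<r}" for x
        using that by (simp add: dx_def K_def deriv_on_interior interior_open)
      then have "W12_norm {l<..<r} (\<lambda>x. v x t) = sqrt (integral {l..r} (\<lambda>x. (v x t)\<^sup>2)
          + integral {l..r} (\<lambda>x. (dx K v x t)\<^sup>2))"
        unfolding W12_norm_def using P.slices t
        by (subst (1 2) lebesgue_integral_Ioo_eq_integral) (auto intro!: continuous_intros)
      then show "ereal (W12_norm {l<..<r} (\<lambda>x. v x t)) \<le> ereal (sqrt B)" using B(1)[OF t] by simp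
      have "continuous_on {l..r} (\<lambda>x. \<theta> x t)" using P.slices t by blast
      then show "Linfty_norm {l<..<r} (\<lambda>x. \<theta> x t) \<le> ereal B"
        using B(2)[OF t] by (intro Linfty_norm_le) (auto elim: continuous_on_subset)
    qed
    have "\<forall>\<^sub>F t in at_left T. t \<in> {0<..<T}"
      using T by (intro eventually_at_leftI[of 0]) auto
    from eventually_mono[OF this norms]
    have "Limsup (at_left T) (\<lambda>t. ereal (W12_norm {l<..<r} (\<lambda>x. v x t))
        + Linfty_norm {l<..<r} (\<lambda>x. \<theta> x t)) \<le> ereal (sqrt B) + ereal B"
      by (rule Limsup_bounded)
    moreover have "Limsup (at_left T) (\<lambda>t. ereal (W12_norm {l<..<r} (\<lambda>x. v x t))
        + Linfty_norm {l<..<r} (\<lambda>x. \<theta> x t)) = \<infinity>"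
      using sol T by (simp add: maximal_classical_solution_def Let_def time_sets v_def)
    ultimately show False by simp
  qed
  show ?thesis
    by (intro exI[of _ \<delta>] conjI allI impI \<delta>, elim conjE, rule bound) assumption+
qed

end
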